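(* Assume that $n\geq4$ (equivalently $\dim V\geq3$). Then for every place $\nu$ of $\mathbb{Q}$ and for every $Q_0\in V(\mathbb{Q}_\nu)$, we have $$\alpha_{\mathrm{ess}}^{\nu}(Q_0)\leq 2.$$
   Context: Let $F\in\mathbb{Z}[x_0,\ldots,x_n]$ be an integral non-degenerate quadratic form and $V\subset\mathbb{P}^n$ the projective quadric $F=0$ over $\mathbb{Q}$, assumed to satisfy $V(\mathbb{Q})\neq\varnothing$. Let $H:\mathbb{P}^n(\mathbb{Q})\to\mathbb{R}_{>0}$ be the naive height: $H([x_0:\cdots:x_n])=\max_i|x_i|$ for coprime integers $x_0,\ldots,x_n$. For a place $\nu$ of $\mathbb{Q}$ (real, with $\mathbb{Q}_\nu=\mathbb{R}$, or $p$-adic), let $d_\nu$ be a projective distance function on $\mathbb{P}^n(\mathbb{Q}_\nu)$, e.g. $d_\nu([x],[y])=\max_{i<j}|x_iy_j-x_jy_i|_\nu/(\max_i|x_i|_\nu\max_i|y_i|_\nu)$ (the constants below do not depend on this choice). For $Q_0\in V(\mathbb{Q}_\nu)$ and a subvariety $Y\subset V$, the approximation constant $\alpha^\nu(Q_0,Y)$ is the infimum of the $\gamma>0$ such that there exist infinitely many points $P\in Y(\mathbb{Q})$ with $d_\nu(P,Q_0)^\gamma H(P)<1$. The essential constant of $Q_0$ is $\alpha_{\mathrm{ess}}^\nu(Q_0)=\sup_{Y}\alpha^\nu(Q_0,Y)$, where $Y$ ranges over all open dense subvarieties of $V$ (over $\mathbb{Q}$). *)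

theory Defs
  imports "HOL-Analysis.Analysis" "HOL-Library.Poly_Mapping"
begin

section \<open>Projective space\<close>

text \<open>Projective space of dimension \<open>CARD('n) - 1\<close> over a field, with homogeneous
  coordinates indexed by the finite type \<open>'n\<close>.  The quotient is partial: the zero vector
  represents no point, so \<open>abs_ppoint 0\<close> is unspecified.\<close>

definition proj_rel :: "'a::field ^ 'n::finite \<Rightarrow> 'a ^ 'n \<Rightarrow> bool" where
  "proj_rel x y \<longleftrightarrow> x \<noteq> 0 \<and> y \<noteq> 0 \<and> (\<exists>c. c \<noteq> 0 \<and> y = c *s x)"

lemma part_equivp_proj_rel: "part_equivp (proj_rel :: 'a::field ^ 'n::finite \<Rightarrow> _)"
proof (rule part_equivpI)
  have "proj_rel (vec 1 :: 'a ^ 'n) (vec 1)"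
    unfolding proj_rel_def by (auto simp: vec_eq_iff intro!: exI[of _ 1])
  then show "\<exists>x :: 'a ^ 'n. proj_rel x x" by blast
  show "symp (proj_rel :: 'a ^ 'n \<Rightarrow> _)"
  proof (rule sympI)
    fix x y :: "'a ^ 'n"
    assume "proj_rel x y"
    then obtain c where "x \<noteq> 0" "y \<noteq> 0" "c \<noteq> 0" "y = c *s x"
      by (auto simp: proj_rel_def)
    then have "x = inverse c *s y" by (simp add: vec_eq_iff)
    with \<open>c \<noteq> 0\<close> \<open>x \<noteq> 0\<close> \<open>y \<noteq> 0\<close> show "proj_rel y x"
      unfolding proj_rel_def by (metis nonzero_imp_inverse_nonzero)
  qed
  show "transp (proj_rel :: 'a ^ 'n \<Rightarrow> _)"
    unfolding transp_def proj_rel_def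
    by (metis mult_eq_0_iff vector_smult_assoc)
qed

quotient_type (overloaded) ('a, 'n) ppoint = "'a::field ^ 'n::finite" / partial: proj_rel
  by (rule part_equivp_proj_rel)

lift_definition rat_point :: "(rat, 'n::finite) ppoint \<Rightarrow> ('a::field_char_0, 'n) ppoint"
  is "\<lambda>x. \<chi> i. of_rat (x $ i)"
proof -
  fix x y :: "rat ^ 'n"
  assume "proj_rel x y"
  then obtain c where c: "x \<noteq> 0" "y \<noteq> 0" "c \<noteq> 0" "y = c *s x"
    by (auto simp: proj_rel_def)
  have "(\<chi> i. of_rat (y $ i)) = (of_rat c :: 'a) *s (\<chi> i. of_rat (x $ i))"
    using c by (simp add: vec_eq_iff of_rat_mult)
  moreover have "(of_rat c :: 'a) \<noteq> 0" using c by simp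
  moreover have "((\<chi> i. of_rat (x $ i)) :: 'a ^ 'n) \<noteq> 0" "((\<chi> i. of_rat (y $ i)) :: 'a ^ 'n) \<noteq> 0"
    using c(1,2) by (simp_all add: vec_eq_iff)
  ultimately show "proj_rel ((\<chi> i. of_rat (x $ i)) :: 'a ^ 'n) (\<chi> i. of_rat (y $ i))"
    unfolding proj_rel_def by blast
qed


section \<open>Polynomials and the Zariski topology\<close>

text \<open>The polynomial ring \<open>'c[x\<^sub>i | i \<in> 'n]\<close>: finitely supported maps from exponent
  vectors to coefficients.\<close>

type_synonym ('n, 'c) mpoly = "('n \<Rightarrow>\<^sub>0 nat) \<Rightarrow>\<^sub>0 'c"

definition homogeneous :: "nat \<Rightarrow> ('n::finite, 'c::zero) mpoly \<Rightarrow> bool" where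
  "homogeneous d G \<longleftrightarrow> (\<forall>m \<in> Poly_Mapping.keys G. (\<Sum>i\<in>UNIV. Poly_Mapping.lookup m i) = d)"

text \<open>Evaluation along a coefficient homomorphism \<open>h\<close> (here always \<open>of_int\<close> or \<open>of_rat\<close>).\<close>

definition meval ::
    "('c \<Rightarrow> 'a) \<Rightarrow> ('n::finite, 'c::zero) mpoly \<Rightarrow> 'a::field ^ 'n \<Rightarrow> 'a" where
  "meval h G x = (\<Sum>m\<in>Poly_Mapping.keys G. h (Poly_Mapping.lookup G m) * (\<Prod>i\<in>UNIV. (x $ i) ^ Poly_Mapping.lookup m i))"

definition vanishes_at ::
    "('c \<Rightarrow> 'a) \<Rightarrow> ('n::finite, 'c::zero) mpoly \<Rightarrow> ('a::field, 'n) ppoint \<Rightarrow> bool" where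
  "vanishes_at h G P \<longleftrightarrow> (\<forall>x. x \<noteq> 0 \<and> abs_ppoint x = P \<longrightarrow> meval h G x = 0)"

text \<open>Varieties over \<open>\<rat>\<close> are represented by their sets of complex points, with the Zariski
  topology whose closed sets are defined by polynomials with rational coefficients.
  By the Nullstellensatz these closed sets correspond bijectively to the closed subsets of
  the scheme of the same dimension over \<open>\<rat>\<close>, so density has its usual meaning.\<close>

definition zariski_closed :: "(complex, 'n::finite) ppoint set \<Rightarrow> bool" where
  "zariski_closed Z \<longleftrightarrow>
     (\<exists>S :: ('n, rat) mpoly set.
        (\<forall>G\<in>S. \<exists>d. homogeneous d G) \<and> Z = {P. \<forall>G\<in>S. vanishes_at of_rat G P})"

definition open_dense_in ::
    "(complex, 'n::finite) ppoint set \<Rightarrow> (complex, 'n) ppoint set \<Rightarrow> bool" where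
  "open_dense_in Y V \<longleftrightarrow>
     (\<exists>Z. zariski_closed Z \<and> Y = V - Z) \<and> (\<forall>W. zariski_closed W \<and> Y \<subseteq> W \<longrightarrow> V \<subseteq> W)"

definition rational_points ::
    "(complex, 'n::finite) ppoint set \<Rightarrow> (rat, 'n) ppoint set" where
  "rational_points Y = {P. rat_point P \<in> Y}"


section \<open>Quadrics\<close>

definition nondegenerate :: "('n::finite, int) mpoly \<Rightarrow> bool" where
  "nondegenerate F \<longleftrightarrow>
     (\<forall>x :: rat ^ 'n.
        (\<forall>y. meval of_int F (x + y) - meval of_int F x - meval of_int F y = 0) \<longrightarrow> x = 0)"

definition quadric :: "('n::finite, int) mpoly \<Rightarrow> ('a::field, 'n) ppoint set" where
  "quadric F = {P. vanishes_at of_int F P}"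


section \<open>Places of the rational numbers and completions\<close>

definition padic_abs :: "nat \<Rightarrow> rat \<Rightarrow> real" where
  "padic_abs p r =
     (if r = 0 then 0
      else real p powi (int (multiplicity (int p) (snd (quotient_of r)))
                        - int (multiplicity (int p) (fst (quotient_of r)))))"

text \<open>A place is represented by its normalised absolute value.\<close>

definition place :: "(rat \<Rightarrow> real) \<Rightarrow> bool" where
  "place \<nu> \<longleftrightarrow> \<nu> = (\<lambda>r. \<bar>of_rat r\<bar>) \<or> (\<exists>p. prime p \<and> \<nu> = padic_abs p)"

text \<open>The field \<open>'k\<close> with absolute value \<open>av\<close> is the completion of \<open>\<rat>\<close> with respect to
  \<open>\<nu>\<close>.  This determines \<open>('k, av)\<close> up to unique isometric isomorphism.\<close>

definition completion_of_rat :: "(rat \<Rightarrow> real) \<Rightarrow> ('k::field_char_0 \<Rightarrow> real) \<Rightarrow> bool" where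
  "completion_of_rat \<nu> av \<longleftrightarrow>
     (\<forall>x. 0 \<le> av x) \<and> (\<forall>x. av x = 0 \<longleftrightarrow> x = 0) \<and>
     (\<forall>x y. av (x * y) = av x * av y) \<and> (\<forall>x y. av (x + y) \<le> av x + av y) \<and>
     (\<forall>r. av (of_rat r) = \<nu> r) \<and>
     (\<forall>x. \<forall>e>0. \<exists>r. av (x - of_rat r) < e) \<and>
     (\<forall>X :: nat \<Rightarrow> 'k.
        (\<forall>e>0. \<exists>N. \<forall>m\<ge>N. \<forall>n\<ge>N. av (X m - X n) < e) \<longrightarrow>
        (\<exists>L. \<forall>e>0. \<exists>N. \<forall>n\<ge>N. av (X n - L) < e))"

lemma completion_of_rat_real:
  "completion_of_rat (\<lambda>r. \<bar>of_rat r\<bar>) (\<lambda>x::real. \<bar>x\<bar>)"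
proof -
  have dense: "\<exists>r. \<bar>x - of_rat r\<bar> < e" if "e > 0" for x e :: real
  proof -
    from that obtain r where "x < of_rat r" "of_rat r < x + e"
      using of_rat_dense[of x "x + e"] by auto
    then show ?thesis by (intro exI[of _ r]) auto
  qed
  have complete: "\<exists>L. \<forall>e>0. \<exists>N. \<forall>n\<ge>N. \<bar>X n - L\<bar> < e"
    if "\<forall>e>0. \<exists>N. \<forall>m\<ge>N. \<forall>n\<ge>N. \<bar>X m - X n\<bar> < e" for X :: "nat \<Rightarrow> real"
  proof -
    have "Cauchy X" using that by (simp add: Cauchy_def dist_real_def)
    then obtain L where "X \<longlonglongrightarrow> L"
      using real_Cauchy_convergent convergent_def by blast
    then have "\<forall>e>0. \<exists>N. \<forall>n\<ge>N. \<bar>X n - L\<bar> < e"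
      by (simp add: lim_sequentially dist_real_def)
    then show ?thesis ..
  qed
  show ?thesis
    unfolding completion_of_rat_def using dense complete by (auto simp: abs_mult)
qed


section \<open>Height, distance and approximation constants\<close>

definition height :: "(rat, 'n::finite) ppoint \<Rightarrow> real" where
  "height P =
     (THE h. \<exists>z :: int ^ 'n.
        Gcd (range (($) z)) = 1 \<and> P = abs_ppoint (\<chi> i. of_int (z $ i)) \<and>
        h = real_of_int (Max (range (\<lambda>i. \<bar>z $ i\<bar>))))"

text \<open>Since \<open>av\<close> is multiplicative and \<open>av (- 1) = 1\<close>, the value does not depend on the
  representatives, and the maximum over all \<open>(i, j)\<close> equals that over \<open>i < j\<close>.\<close>

definition pdist ::
    "('k::field \<Rightarrow> real) \<Rightarrow> ('k, 'n::finite) ppoint \<Rightarrow> ('k, 'n) ppoint \<Rightarrow> real" where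
  "pdist av P Q =
     (let x = rep_ppoint P; y = rep_ppoint Q in
        Max (range (\<lambda>(i, j). av (x $ i * y $ j - x $ j * y $ i)))
        / (Max (range (\<lambda>i. av (x $ i))) * Max (range (\<lambda>i. av (y $ i)))))"

text \<open>Extended reals: the infimum of the empty set is \<open>\<infinity>\<close>.  For \<open>P = Q\<^sub>0\<close> the
  condition holds, as \<open>0 powr \<gamma> = 0\<close>.\<close>

definition approx_const ::
    "('k::field_char_0 \<Rightarrow> real) \<Rightarrow> ('k, 'n::finite) ppoint
      \<Rightarrow> (complex, 'n) ppoint set \<Rightarrow> ereal" where
  "approx_const av Q\<^sub>0 Y =
     Inf {ereal \<gamma> |\<gamma>. 0 < \<gamma> \<and>
       infinite {P \<in> rational_points Y. pdist av (rat_point P) Q\<^sub>0 powr \<gamma> * height P < 1}}"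

definition ess_const ::
    "('k::field_char_0 \<Rightarrow> real) \<Rightarrow> (complex, 'n::finite) ppoint set
      \<Rightarrow> ('k, 'n) ppoint \<Rightarrow> ereal" where
  "ess_const av V Q\<^sub>0 = Sup {approx_const av Q\<^sub>0 Y |Y. open_dense_in Y V}"


subsection \<open>Independence of the choices\<close>

lemma abs_ppoint_eq_iff:
  assumes "x \<noteq> 0" "y \<noteq> 0"
  shows "abs_ppoint x = abs_ppoint y \<longleftrightarrow> proj_rel x y"
proof -
  have refl: "proj_rel u u" if "u \<noteq> 0" for u :: "'a ^ 'b"
    using that unfolding proj_rel_def by (auto intro!: exI[of _ 1])
  show ?thesis
    using Quotient3_rel[OF Quotient3_ppoint, of x y] refl assms by blast
qed

lemma rep_ppoint_nonzero: "rep_ppoint P \<noteq> 0"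
  using Quotient3_rep_reflp[OF Quotient3_ppoint, of P] by (simp add: proj_rel_def)

lemma rep_abs_ppoint:
  assumes "x \<noteq> 0"
  obtains c where "c \<noteq> 0" "rep_ppoint (abs_ppoint x) = c *s x"
proof -
  have "abs_ppoint x = abs_ppoint (rep_ppoint (abs_ppoint x))"
    by (simp add: Quotient3_abs_rep[OF Quotient3_ppoint])
  then have "proj_rel x (rep_ppoint (abs_ppoint x))"
    using abs_ppoint_eq_iff[OF assms rep_ppoint_nonzero] by blast
  then show ?thesis using that by (auto simp: proj_rel_def)
qed

lemma Max_range_mult:
  fixes f :: "'i::finite \<Rightarrow> real"
  assumes "0 \<le> a"
  shows "Max (range (\<lambda>i. a * f i)) = a * Max (range f)"
proof -
  have "mono (\<lambda>t. a * t)" using assms by (simp add: mono_def mult_left_mono)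
  from mono_Max_commute[OF this, of "range f"] show ?thesis by (simp add: image_image)
qed

lemma pdist_abs_ppoint:
  fixes x y :: "'k::field_char_0 ^ 'n::finite"
  assumes K: "completion_of_rat \<nu> av" and x: "x \<noteq> 0" and y: "y \<noteq> 0"
  shows "pdist av (abs_ppoint x) (abs_ppoint y) =
     Max (range (\<lambda>(i, j). av (x $ i * y $ j - x $ j * y $ i)))
     / (Max (range (\<lambda>i. av (x $ i))) * Max (range (\<lambda>i. av (y $ i))))"
proof -
  have pos: "0 \<le> av u" and zero: "av u = 0 \<longleftrightarrow> u = 0" and mult: "av (u * v) = av u * av v"
    for u v using K by (auto simp: completion_of_rat_def)
  obtain c where c: "c \<noteq> 0" "rep_ppoint (abs_ppoint x) = c *s x" by (rule rep_abs_ppoint[OF x])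
  obtain d where d: "d \<noteq> 0" "rep_ppoint (abs_ppoint y) = d *s y" by (rule rep_abs_ppoint[OF y])
  have "av (c * x $ i * (d * y $ j) - c * x $ j * (d * y $ i))
      = av c * av d * av (x $ i * y $ j - x $ j * y $ i)" for i j
  proof -
    have "c * x $ i * (d * y $ j) - c * x $ j * (d * y $ i)
      = (c * d) * (x $ i * y $ j - x $ j * y $ i)" by (simp add: algebra_simps)
    then show ?thesis by (simp only: mult)
  qed
  then have "range (\<lambda>(i, j). av (c * x $ i * (d * y $ j) - c * x $ j * (d * y $ i)))
      = range (\<lambda>p. av c * av d * (\<lambda>(i, j). av (x $ i * y $ j - x $ j * y $ i)) p)"
    by (intro image_cong) auto
  moreover have "av c \<noteq> 0" "av d \<noteq> 0" using c d zero by auto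
  ultimately show ?thesis
    unfolding pdist_def Let_def c(2) d(2)
    by (simp add: mult Max_range_mult pos del: image_mult_atLeastAtMost)
qed

lemma primitive_unique:
  fixes z w :: "int ^ 'n::finite"
  assumes z: "Gcd (range (($) z)) = 1" and w: "Gcd (range (($) w)) = 1"
    and eq: "abs_ppoint ((\<chi> i. of_int (z $ i)) :: rat ^ 'n) = abs_ppoint (\<chi> i. of_int (w $ i))"
  shows "w = z \<or> w = - z"
proof -
  have nz: "((\<chi> i. of_int (u $ i)) :: rat ^ 'n) \<noteq> 0" if "Gcd (range (($) u)) = 1" for u :: "int ^ 'n"
  proof
    assume "((\<chi> i. of_int (u $ i)) :: rat ^ 'n) = 0"
    then have "range (($) u) \<subseteq> {0}" by (auto simp: vec_eq_iff)
    then have "Gcd (range (($) u)) = 0" by (simp add: Gcd_0_iff)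
    with that show False by simp
  qed
  from eq obtain c :: rat where c: "\<And>i. of_int (w $ i) = c * of_int (z $ i)"
    unfolding abs_ppoint_eq_iff[OF nz[OF z] nz[OF w]] proj_rel_def
    by (auto simp: vec_eq_iff)
  obtain a b where ab: "quotient_of c = (a, b)" by (cases "quotient_of c")
  then have b: "b > 0" and c_eq: "c = of_int a / of_int b"
    using quotient_of_denom_pos quotient_of_div by blast+
  have rel: "b * w $ i = a * z $ i" for i
  proof -
    have "(of_int (b * w $ i) :: rat) = of_int (a * z $ i)"
      using c[of i] b by (simp add: c_eq field_simps)
    then show ?thesis by (simp only: of_int_eq_iff)
  qed
  have "Gcd (range (\<lambda>i. b * w $ i)) = normalize (b * Gcd (range (($) w)))"
    using Gcd_mult[of b "range (($) w)"] by (simp add: image_image)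
  moreover have "Gcd (range (\<lambda>i. a * z $ i)) = normalize (a * Gcd (range (($) z)))"
    using Gcd_mult[of a "range (($) z)"] by (simp add: image_image)
  ultimately have "\<bar>a\<bar> = b" using rel z w b by simp
  then consider "a = b" | "a = - b" by linarith
  then show ?thesis
  proof cases
    case 1 then show ?thesis using rel b by (auto simp: vec_eq_iff)
  next
    case 2
    then have "w $ i = - z $ i" for i
      using rel[of i] b by (metis minus_mult_commute mult_cancel_left less_irrefl)
    then show ?thesis by (auto simp: vec_eq_iff)
  qed
qed

lemma height_primitive:
  fixes z :: "int ^ 'n::finite"
  assumes "Gcd (range (($) z)) = 1"
  shows "height (abs_ppoint (\<chi> i. of_int (z $ i))) = real_of_int (Max (range (\<lambda>i. \<bar>z $ i\<bar>)))"
  unfolding height_def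
proof (rule the_equality)
  show "\<exists>w :: int ^ 'n. Gcd (range (($) w)) = 1 \<and>
      (abs_ppoint (\<chi> i. of_int (z $ i)) :: (rat, 'n) ppoint) = abs_ppoint (\<chi> i. of_int (w $ i)) \<and>
      real_of_int (Max (range (\<lambda>i. \<bar>z $ i\<bar>))) = real_of_int (Max (range (\<lambda>i. \<bar>w $ i\<bar>)))"
    using assms by blast
next
  fix h
  assume "\<exists>w :: int ^ 'n. Gcd (range (($) w)) = 1 \<and>
      (abs_ppoint (\<chi> i. of_int (z $ i)) :: (rat, 'n) ppoint) = abs_ppoint (\<chi> i. of_int (w $ i)) \<and>
      h = real_of_int (Max (range (\<lambda>i. \<bar>w $ i\<bar>)))"
  then obtain w :: "int ^ 'n" where w: "w = z \<or> w = - z"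
      and h: "h = real_of_int (Max (range (\<lambda>i. \<bar>w $ i\<bar>)))"
    using primitive_unique[OF assms] by blast
  have "(\<lambda>i. \<bar>w $ i\<bar>) = (\<lambda>i. \<bar>z $ i\<bar>)" using w by auto
  then show "h = real_of_int (Max (range (\<lambda>i. \<bar>z $ i\<bar>)))" unfolding h by (rule arg_cong)
qed

end

theory Submission
  imports Defs
begin

text \<open>The quadric is parametrised by projection from a rational point on it.  Write \<open>B\<close> for the
  polar form of \<open>F\<close> and let \<open>p\<close> be an integer vector with \<open>F(p) = 0\<close>.  The quadratic map
  \<open>\<phi>(t) = F(t) p - B(p,t) t\<close> (\<open>stereo\<close> below) takes its values in the cone \<open>F = 0\<close>, and
  \<open>\<phi>(q) = - B(p,q) q\<close> whenever \<open>F(q) = 0\<close>.  Let \<open>q\<close> represent \<open>Q\<^sub>0\<close>.  Since \<open>F\<close> is nondegenerate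
  and has a rational zero, \<open>p\<close> can be chosen with \<open>B(p,q) \<noteq> 0\<close> (\<open>isotropic_transversal\<close>), and then \<open>\<phi>\<close> carries points near
  \<open>q\<close> to points near \<open>Q\<^sub>0\<close> with a Lipschitz bound (\<open>stereo_estimate\<close>).  By mere rounding, \<open>q\<close> has
  rational approximations within \<open>O(1/N)\<close> that are proportional to integer vectors of size \<open>O(N)\<close>
  (\<open>integer_approximation\<close>).  Their images \<open>P\<close> under \<open>\<phi>\<close> satisfy \<open>d(P,Q\<^sub>0) = O(1/N)\<close> and
  \<open>H(P) = O(N\<^sup>2)\<close>, so \<open>d(P,Q\<^sub>0)\<^sup>\<gamma> H(P) = O(N\<^sup>2 / N\<^sup>\<gamma>)\<close> is small for every \<open>\<gamma> > 2\<close>.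

  The points \<open>P\<close> must moreover lie in the given open dense \<open>Y\<close> and take infinitely many values.
  Rounding leaves room for \<open>D + 1\<close> choices in each coordinate, for any fixed \<open>D\<close>, and a nonzero
  polynomial of degree at most \<open>D\<close> in each variable cannot vanish on all of such a grid
  (\<open>coordpoly_grid\<close>).  If a form \<open>G\<close> vanishes off \<open>Y\<close> on the quadric but not identically on \<open>Y\<close>,
  it remains to know that \<open>G \<circ> \<phi>\<close> is not the zero polynomial; it is nonzero at every \<open>x\<close> on the
  quadric with \<open>G(x) \<noteq> 0\<close> and \<open>B(p,x) \<noteq> 0\<close>, and density of \<open>Y\<close> supplies such an \<open>x\<close>
  (\<open>dense_open_point\<close>).  Infinity follows from \<open>d(P,Q\<^sub>0) \<rightarrow> 0\<close> as soon as \<open>P \<noteq> Q\<^sub>0\<close>; to guarantee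
  this when \<open>Q\<^sub>0\<close> is rational, the points are also kept off a rational hyperplane through \<open>Q\<^sub>0\<close> and
  \<open>[p]\<close> (\<open>annihilating_form\<close>).\<close>

section \<open>The quadratic form and its polar form\<close>

text \<open>A quadratic monomial is written as an ordered pair of variables, so that \<open>F\<close> and its polar form
  are sums over the monomials of \<open>F\<close> that make sense over every commutative ring, in particular over
  the integers and without dividing by \<open>2\<close>.\<close>

definition quad_pair :: "('n::finite \<Rightarrow>\<^sub>0 nat) \<Rightarrow> 'n \<times> 'n" where
  "quad_pair m = (SOME (i, j). \<forall>k. Poly_Mapping.lookup m k = of_bool (k = i) + of_bool (k = j))"

lemma quad_pair:
  assumes "(\<Sum>i\<in>UNIV. Poly_Mapping.lookup m i) = 2"
  shows "Poly_Mapping.lookup m k = of_bool (k = fst (quad_pair m)) + of_bool (k = snd (quad_pair m))"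
proof -
  obtain i where i: "Poly_Mapping.lookup m i > 0"
    using assms by (metis gr0I sum.neutral zero_neq_numeral)
  define g where "g = (\<lambda>k. Poly_Mapping.lookup m k - of_bool (k = i))"
  have m_g: "Poly_Mapping.lookup m k = of_bool (k = i) + g k" for k
    using i by (auto simp: g_def)
  have "(\<Sum>k\<in>UNIV. Poly_Mapping.lookup m k) = (\<Sum>k\<in>UNIV. of_bool (k = i)) + (\<Sum>k\<in>UNIV. g k)"
    by (simp add: m_g sum.distrib)
  also have "(\<Sum>k\<in>UNIV. of_bool (k = i)) = (1::nat)"
    by (simp add: of_bool_def)
  finally have "(\<Sum>k\<in>UNIV. g k) = 1"
    using assms by simp
  then obtain j where j: "g j = 1" "\<forall>k\<in>UNIV. j \<noteq> k \<longrightarrow> g k = 0"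
    by (metis sum_eq_1_iff finite)
  have "g k = of_bool (k = j)" for k
    using j by (cases "k = j") auto
  then have "\<exists>ij. case ij of (i, j) \<Rightarrow>
      \<forall>k. Poly_Mapping.lookup m k = of_bool (k = i) + of_bool (k = j)"
    using m_g by (intro exI[of _ "(i, j)"]) simp
  then have "case quad_pair m of (i, j) \<Rightarrow>
      \<forall>k. Poly_Mapping.lookup m k = of_bool (k = i) + of_bool (k = j)"
    unfolding quad_pair_def by (rule someI_ex)
  then show ?thesis by (auto split: prod.splits)
qed

lemma prod_power_of_bool:
  fixes x :: "'n::finite \<Rightarrow> 'a::comm_semiring_1"
  shows "(\<Prod>k\<in>UNIV. x k ^ (of_bool (k = i) + of_bool (k = j))) = x i * x j"
proof -
  have "(\<Prod>k\<in>UNIV. x k ^ of_bool (k = a)) = x a" for a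
  proof -
    have "(\<Prod>k\<in>UNIV. x k ^ of_bool (k = a)) = (\<Prod>k\<in>UNIV. if k = a then x k else 1)"
      by (rule prod.cong) auto
    then show ?thesis by simp
  qed
  then show ?thesis by (simp add: power_add prod.distrib)
qed

definition qform :: "('n::finite, int) mpoly \<Rightarrow> 'a::comm_ring_1 ^ 'n \<Rightarrow> 'a" where
  "qform F x = (\<Sum>m\<in>Poly_Mapping.keys F. of_int (Poly_Mapping.lookup F m) *
     (x $ fst (quad_pair m) * x $ snd (quad_pair m)))"

definition qbil :: "('n::finite, int) mpoly \<Rightarrow> 'a::comm_ring_1 ^ 'n \<Rightarrow> 'a ^ 'n \<Rightarrow> 'a" where
  "qbil F x y = (\<Sum>m\<in>Poly_Mapping.keys F. of_int (Poly_Mapping.lookup F m) *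
     (x $ fst (quad_pair m) * y $ snd (quad_pair m) + y $ fst (quad_pair m) * x $ snd (quad_pair m)))"

lemma meval_quadratic:
  assumes "homogeneous 2 F"
  shows "meval of_int F x = qform F x"
  unfolding meval_def qform_def
proof (rule sum.cong)
  fix m assume "m \<in> Poly_Mapping.keys F"
  then have "(\<Sum>i\<in>UNIV. Poly_Mapping.lookup m i) = 2"
    using assms by (auto simp: homogeneous_def)
  from quad_pair[OF this]
  have "(\<Prod>i\<in>UNIV. x $ i ^ Poly_Mapping.lookup m i)
      = (\<Prod>k\<in>UNIV. x $ k ^ (of_bool (k = fst (quad_pair m)) + of_bool (k = snd (quad_pair m))))"
    by simp
  also have "\<dots> = x $ fst (quad_pair m) * x $ snd (quad_pair m)"
    by (rule prod_power_of_bool)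
  finally show "of_int (Poly_Mapping.lookup F m) * (\<Prod>i\<in>UNIV. x $ i ^ Poly_Mapping.lookup m i)
      = of_int (Poly_Mapping.lookup F m) * (x $ fst (quad_pair m) * x $ snd (quad_pair m))"
    by simp
qed simp

lemma qform_add: "qform F (x + y) = qform F x + qform F y + qbil F x y"
  by (simp add: qform_def qbil_def algebra_simps flip: sum.distrib)

lemma qform_scale: "qform F (c *s x) = c\<^sup>2 * qform F x"
  by (simp add: qform_def sum_distrib_left power2_eq_square mult_ac)

lemma qbil_commute: "qbil F x y = qbil F y x"
  by (simp add: qbil_def add.commute)

lemma qbil_add_right: "qbil F x (y + z) = qbil F x y + qbil F x z"
  by (simp add: qbil_def algebra_simps flip: sum.distrib)

lemma qbil_scale_right: "qbil F x (c *s y) = c * qbil F x y"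
  by (simp add: qbil_def sum_distrib_left algebra_simps)

lemma qbil_diff_right: "qbil F x (y - z) = qbil F x y - qbil F x z"
  by (metis add_diff_cancel diff_add_cancel qbil_add_right)

lemma qbil_add_left: "qbil F (x + y) z = qbil F x z + qbil F y z"
  by (metis qbil_add_right qbil_commute)

lemma qbil_scale_left: "qbil F (c *s x) y = c * qbil F x y"
  by (metis qbil_scale_right qbil_commute)

lemma qbil_sum_right: "qbil F x (\<Sum>i\<in>I. f i) = (\<Sum>i\<in>I. qbil F x (f i))"
  by (induction I rule: infinite_finite_induct)
     (auto simp: qbil_add_right, simp_all add: qbil_def)

lemma qbil_self: "qbil F x x = 2 * qform F x"
  by (simp add: qform_def qbil_def sum_distrib_left algebra_simps)

text \<open>All rational points involved are represented by integer vectors, which map to the rational,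
  complex and completed coordinate spaces alike.\<close>

definition ivec :: "int ^ 'n \<Rightarrow> 'a::ring_1 ^ 'n" where
  "ivec z = (\<chi> i. of_int (z $ i))"

lemma ivec_nth [simp]: "ivec z $ i = of_int (z $ i)"
  by (simp add: ivec_def)

lemma ivec_add: "ivec (x + y) = ivec x + ivec y"
  by (simp add: vec_eq_iff)

lemma ivec_eq_0_iff [simp]: "(ivec z :: 'a::ring_char_0 ^ 'n) = 0 \<longleftrightarrow> z = 0"
  by (simp add: vec_eq_iff)

lemma qform_ivec: "qform F (ivec x) = of_int (qform F x)"
  by (simp add: qform_def)

lemma qbil_ivec: "qbil F (ivec x) (ivec y) = of_int (qbil F x y)"
  by (simp add: qbil_def)

definition lform :: "int ^ 'n::finite \<Rightarrow> 'a::comm_ring_1 ^ 'n \<Rightarrow> 'a" where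
  "lform l x = (\<Sum>i\<in>UNIV. of_int (l $ i) * x $ i)"

lemma lform_add: "lform l (x + y) = lform l x + lform l y"
  by (simp add: lform_def algebra_simps sum.distrib)

lemma lform_0 [simp]: "lform l 0 = 0"
  by (simp add: lform_def)

lemma lform_diff: "lform l (x - y) = lform l x - lform l y"
  by (simp add: lform_def algebra_simps sum_subtractf)

lemma lform_scale: "lform l (c *s x) = c * lform l x"
  by (simp add: lform_def sum_distrib_left mult_ac)

lemma lform_ivec: "lform l (ivec x) = of_int (lform l x)"
  by (simp add: lform_def)

lemma lform_axis [simp]: "lform l (axis i 1) = of_int (l $ i)"
  by (simp add: lform_def axis_def if_distrib cong: if_cong)

lemma lform_commute: "lform l x = lform x (l :: int ^ 'n::finite)"
  by (simp add: lform_def mult.commute)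

definition gradient :: "('n::finite, int) mpoly \<Rightarrow> int ^ 'n \<Rightarrow> int ^ 'n" where
  "gradient F p = (\<chi> i. qbil F p (axis i 1))"

lemma qbil_gradient:
  fixes x :: "'a::comm_ring_1 ^ 'n::finite"
  shows "qbil F (ivec p) x = lform (gradient F p) x"
proof -
  have "x = (\<Sum>j\<in>UNIV. x $ j *s ivec (axis j 1))"
    by (simp add: vec_eq_iff axis_def if_distrib cong: if_cong)
  then have "qbil F (ivec p) x = (\<Sum>j\<in>UNIV. x $ j * qbil F (ivec p) (ivec (axis j 1)))"
    by (metis (no_types, lifting) qbil_sum_right qbil_scale_right sum.cong)
  then show ?thesis
    by (simp add: lform_def gradient_def qbil_ivec mult.commute)
qed

lemma clear_denominators:
  fixes x :: "rat ^ 'n::finite"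
  obtains c z where "c \<noteq> 0" "ivec z = of_int c *s x"
proof -
  define d where "d i = snd (quotient_of (x $ i))" for i
  have d: "d i > 0" "x $ i * of_int (d i) = of_int (fst (quotient_of (x $ i)))" for i
  proof -
    obtain a b where ab: "quotient_of (x $ i) = (a, b)" by (cases "quotient_of (x $ i)")
    then show "d i > 0" "x $ i * of_int (d i) = of_int (fst (quotient_of (x $ i)))"
      using quotient_of_denom_pos[OF ab] quotient_of_div[OF ab] by (auto simp: d_def)
  qed
  define c where "c = (\<Prod>i\<in>UNIV. d i)"
  have "\<exists>w. of_int w = of_int c * x $ i" for i
  proof -
    have "c = d i * (\<Prod>j\<in>UNIV - {i}. d j)"
      unfolding c_def by (rule prod.remove) auto
    then have "of_int c * x $ i = of_int (fst (quotient_of (x $ i)) * (\<Prod>j\<in>UNIV - {i}. d j))"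
      using d(2)[of i] by (metis (no_types, lifting) mult.assoc mult.commute of_int_mult)
    then show ?thesis by metis
  qed
  then obtain w where "\<And>i. of_int (w i) = of_int c * x $ i" by metis
  then have "ivec (\<chi> i. w i) = of_int c *s x" by (simp add: vec_eq_iff)
  moreover have "c \<noteq> 0" using d(1) by (simp add: c_def less_imp_neq[THEN not_sym])
  ultimately show thesis using that by blast
qed

text \<open>Nondegeneracy over \<open>\<rat>\<close> passes to every extension field since the Gram matrix, being
  injective over \<open>\<rat>\<close>, has a left inverse with rational entries.\<close>

lemma nondegenerate_extension:
  fixes q :: "'k::field_char_0 ^ 'n::finite"
  assumes F: "homogeneous 2 F" "nondegenerate F" and q: "q \<noteq> 0"
  obtains t where "qbil F (ivec t) q \<noteq> 0"
proof (rule ccontr)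
  assume *: "\<not> thesis"
  define e where "e i = (axis i 1 :: int ^ 'n)" for i
  define M where "M = (\<chi> i j. of_int (gradient F (e i) $ j) :: rat ^ 'n ^ 'n)"
  have M: "(M *v x) $ i = qbil F (ivec (e i)) x" for x i
    by (simp add: matrix_vector_mult_def M_def qbil_gradient lform_def)
  have "inj ((*v) M)"
  proof (subst vec.inj_iff_eq_0, intro allI impI)
    fix x assume "M *v x = 0"
    then have e: "qbil F x (ivec (e i)) = 0" for i
      by (metis M zero_index qbil_commute)
    have "qbil F x y = 0" for y
    proof -
      have "y = (\<Sum>j\<in>UNIV. y $ j *s ivec (e j))"
        by (simp add: vec_eq_iff e_def axis_def if_distrib cong: if_cong)
      then have "qbil F x y = (\<Sum>j\<in>UNIV. y $ j * qbil F x (ivec (e j)))"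
        by (metis (no_types, lifting) qbil_sum_right qbil_scale_right sum.cong)
      then show ?thesis by (simp add: e)
    qed
    then show "x = 0"
      using F by (auto simp: nondegenerate_def meval_quadratic qform_add)
  qed
  then obtain N where "N ** M = mat 1"
    using matrix_left_invertible_injective by blast
  then have N: "(\<Sum>j\<in>UNIV. N $ i $ j * M $ j $ l) = of_bool (i = l)" for i l
    by (auto simp: matrix_matrix_mult_def mat_def vec_eq_iff)
  have "q $ i = 0" for i
  proof -
    have e: "(\<Sum>l\<in>UNIV. of_rat (M $ j $ l) * q $ l) = 0" for j
    proof -
      have "qbil F (ivec (e j)) q = 0"
        using * that by blast
      then show ?thesis
        by (simp add: M_def qbil_gradient lform_def)
    qed
    have "q $ i = (\<Sum>l\<in>UNIV. of_rat (of_bool (i = l)) * q $ l)"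
      by (simp add: of_bool_def if_distrib if_distribR cong: if_cong)
    also have "\<dots> = (\<Sum>l\<in>UNIV. \<Sum>j\<in>UNIV. of_rat (N $ i $ j) * (of_rat (M $ j $ l) * q $ l))"
      by (simp add: of_rat_mult of_rat_sum sum_distrib_right mult.assoc flip: N)
    also have "\<dots> = (\<Sum>j\<in>UNIV. of_rat (N $ i $ j) * (\<Sum>l\<in>UNIV. of_rat (M $ j $ l) * q $ l))"
      by (subst sum.swap) (simp add: sum_distrib_left)
    finally show ?thesis by (simp add: e)
  qed
  with q show False by (simp add: vec_eq_iff)
qed

section \<open>Projection from a rational point\<close>

definition stereo :: "('n::finite, int) mpoly \<Rightarrow> 'a::comm_ring_1 ^ 'n \<Rightarrow> 'a ^ 'n \<Rightarrow> 'a ^ 'n" where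
  "stereo F p x = qform F x *s p - qbil F p x *s x"

lemma stereo_nth [simp]: "stereo F p x $ i = qform F x * p $ i - qbil F p x * x $ i"
  by (simp add: stereo_def)

text \<open>The form equals \<open>F(x)\<^sup>2 F(p) + B(p,x)\<^sup>2 F(x) - F(x) B(p,x)\<^sup>2\<close> at the image of \<open>x\<close>.\<close>

lemma qform_stereo:
  assumes "qform F p = 0"
  shows "qform F (stereo F p x) = 0"
proof -
  have "stereo F p x = qform F x *s p + (- qbil F p x) *s x"
    by (simp add: vec_eq_iff)
  then show ?thesis
    by (simp add: qform_add qform_scale qbil_scale_left qbil_scale_right assms power2_eq_square)
qed

lemma stereo_scale: "stereo F p (c *s x) = c\<^sup>2 *s stereo F p x"
  by (simp add: vec_eq_iff qform_scale qbil_scale_right power2_eq_square algebra_simps)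

lemma stereo_ivec: "stereo F (ivec p) (ivec x) = ivec (stereo F p x)"
  by (simp add: vec_eq_iff qform_ivec qbil_ivec)

text \<open>As a map of projective spaces, the projection fixes the points of the quadric at which
  \<open>B(p,x) \<noteq> 0\<close>.\<close>

lemma stereo_on_quadric: "qform F x = 0 \<Longrightarrow> stereo F p x = (- qbil F p x) *s x"
  by (simp add: vec_eq_iff)

lemma lform_stereo:
  "lform l p = 0 \<Longrightarrow> lform l (stereo F p x) = - qbil F p x * lform l x"
  by (simp add: stereo_def lform_diff lform_scale)

lemma qbil_stereo:
  "qform F p = 0 \<Longrightarrow> qbil F p (stereo F p x) = - (qbil F p x)\<^sup>2"
  by (simp add: stereo_def qbil_diff_right qbil_scale_right qbil_self power2_eq_square)

text \<open>A group is not the union of two proper subgroups, here the kernels of \<open>f\<close> and \<open>g\<close>.\<close>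

lemma common_nonzero:
  fixes f :: "'a::group_add \<Rightarrow> 'b::group_add" and g :: "'a \<Rightarrow> 'c::group_add"
  assumes "\<And>x y. f (x + y) = f x + f y" "\<And>x y. g (x + y) = g x + g y"
    and "f t \<noteq> 0" "g u \<noteq> 0"
  obtains v where "f v \<noteq> 0" "g v \<noteq> 0"
proof (cases "f u = 0 \<and> g t = 0")
  case True
  then show ?thesis using assms that[of "t + u"] by simp
next
  case False
  then show ?thesis using assms that[of t] that[of u] by blast
qed

text \<open>If \<open>p0\<close> is orthogonal to \<open>q\<close>, then \<open>B(\<phi>(v), q) = - B(p0,v) B(v,q)\<close> for the projection \<open>\<phi>\<close> from
  \<open>p0\<close>, and both factors can be made nonzero simultaneously.\<close>

lemma isotropic_transversal:
  fixes q :: "'k::field_char_0 ^ 'n::finite"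
  assumes F: "homogeneous 2 F" "nondegenerate F" and q: "q \<noteq> 0"
    and p0: "p0 \<noteq> 0" "qform F p0 = (0::int)"
  obtains p where "qform F p = (0::int)" "qbil F (ivec p) q \<noteq> 0"
proof (cases "qbil F (ivec p0) q = 0")
  case True
  obtain t where t: "qbil F (ivec t) (ivec p0 :: rat ^ 'n) \<noteq> 0"
    using nondegenerate_extension[OF F, of "ivec p0 :: rat ^ 'n"] p0 by auto
  obtain u where u: "qbil F (ivec u) q \<noteq> 0"
    using nondegenerate_extension[OF F q] .
  obtain v where v: "qbil F p0 v \<noteq> 0" "qbil F (ivec v) q \<noteq> 0"
    by (rule common_nonzero[of "qbil F p0" "\<lambda>v. qbil F (ivec v) q" t u])
       (use t u in \<open>auto simp: qbil_add_right qbil_add_left ivec_add qbil_ivec qbil_commute[of F p0]\<close>)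
  have "qbil F (ivec (stereo F p0 v)) q = - of_int (qbil F p0 v) * qbil F (ivec v) q"
    unfolding stereo_ivec[symmetric] using True
    by (simp add: stereo_def qbil_diff_right qbil_scale_right qbil_commute[of _ _ q] qbil_ivec)
  then show ?thesis
    using v qform_stereo[OF p0(2)] by (intro that[of "stereo F p0 v"]) auto
next
  case False
  then show ?thesis using p0 that by blast
qed

section \<open>Polynomial functions on grids\<close>

text \<open>Polynomial functions enter only through their restrictions to the lines parallel to the
  coordinate axes, with a bound on the degree that is uniform in the line.\<close>

definition coordpoly :: "nat \<Rightarrow> ('a::comm_ring_1 ^ 'n::finite \<Rightarrow> 'a) \<Rightarrow> bool" where
  "coordpoly D f \<longleftrightarrow>
     (\<forall>x i. \<exists>q. degree q \<le> D \<and> (\<forall>s. f (\<chi> j. if j = i then s else x $ j) = poly q s))"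

definition polyfun :: "('a::comm_ring_1 ^ 'n::finite \<Rightarrow> 'a) \<Rightarrow> bool" where
  "polyfun f \<longleftrightarrow> (\<exists>D. coordpoly D f)"

lemma polyfun_const: "polyfun (\<lambda>x. c)"
  unfolding polyfun_def coordpoly_def
  by (rule exI[of _ 0], intro allI, rule exI[of _ "[:c:]"]) auto

lemma polyfun_coord: "polyfun (\<lambda>x :: 'a::comm_ring_1 ^ 'n::finite. x $ k)"
  unfolding polyfun_def coordpoly_def
proof (rule exI[of _ 1], intro allI)
  fix x :: "'a ^ 'n" and i
  show "\<exists>q. degree q \<le> 1 \<and> (\<forall>s. (\<chi> j. if j = i then s else x $ j) $ k = poly q s)"
    by (rule exI[of _ "if k = i then [:0, 1:] else [:x $ k:]"]) auto
qed

lemma polyfun_add: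
  assumes "polyfun f" "polyfun g"
  shows "polyfun (\<lambda>x. f x + g x)"
proof -
  obtain D E where DE: "coordpoly D f" "coordpoly E g"
    using assms by (auto simp: polyfun_def)
  have "coordpoly (max D E) (\<lambda>x. f x + g x)"
    unfolding coordpoly_def
  proof (intro allI)
    fix x i
    obtain p q where "degree p \<le> D" "\<And>s. f (\<chi> j. if j = i then s else x $ j) = poly p s"
      and "degree q \<le> E" "\<And>s. g (\<chi> j. if j = i then s else x $ j) = poly q s"
      using DE unfolding coordpoly_def by metis
    then show "\<exists>r. degree r \<le> max D E \<and> (\<forall>s. f (\<chi> j. if j = i then s else x $ j)
        + g (\<chi> j. if j = i then s else x $ j) = poly r s)"
      by (intro exI[of _ "p + q"]) (auto intro: degree_add_le)
  qed
  then show ?thesis by (auto simp: polyfun_def)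
qed

lemma polyfun_mult:
  assumes "polyfun f" "polyfun g"
  shows "polyfun (\<lambda>x. f x * g x)"
proof -
  obtain D E where DE: "coordpoly D f" "coordpoly E g"
    using assms by (auto simp: polyfun_def)
  have "coordpoly (D + E) (\<lambda>x. f x * g x)"
    unfolding coordpoly_def
  proof (intro allI)
    fix x i
    obtain p q where "degree p \<le> D" "\<And>s. f (\<chi> j. if j = i then s else x $ j) = poly p s"
      and "degree q \<le> E" "\<And>s. g (\<chi> j. if j = i then s else x $ j) = poly q s"
      using DE unfolding coordpoly_def by metis
    then show "\<exists>r. degree r \<le> D + E \<and> (\<forall>s. f (\<chi> j. if j = i then s else x $ j)
        * g (\<chi> j. if j = i then s else x $ j) = poly r s)"
      by (intro exI[of _ "p * q"]) (auto intro: order_trans[OF degree_mult_le])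
  qed
  then show ?thesis by (auto simp: polyfun_def)
qed

lemma polyfun_sum: "(\<And>i. i \<in> I \<Longrightarrow> polyfun (f i)) \<Longrightarrow> polyfun (\<lambda>x. \<Sum>i\<in>I. f i x)"
  by (induction I rule: infinite_finite_induct) (auto simp: polyfun_const polyfun_add)

lemma polyfun_prod: "(\<And>i. i \<in> I \<Longrightarrow> polyfun (f i)) \<Longrightarrow> polyfun (\<lambda>x. \<Prod>i\<in>I. f i x)"
  by (induction I rule: infinite_finite_induct) (auto simp: polyfun_const polyfun_mult)

lemma polyfun_power: "polyfun f \<Longrightarrow> polyfun (\<lambda>x. f x ^ k)"
  by (induction k) (auto simp: polyfun_const polyfun_mult)

lemma polyfun_diff: "polyfun f \<Longrightarrow> polyfun g \<Longrightarrow> polyfun (\<lambda>x. f x - g x)"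
  using polyfun_add[of f "\<lambda>x. (- 1) * g x"] polyfun_mult[OF polyfun_const, of g "- 1"] by simp

lemma polyfun_qform: "polyfun (qform F)"
  unfolding qform_def by (intro polyfun_sum polyfun_mult polyfun_const polyfun_coord)

lemma polyfun_qbil: "polyfun (qbil F a)"
  unfolding qbil_def
  by (intro polyfun_sum polyfun_add polyfun_mult polyfun_const polyfun_coord)

lemma polyfun_lform: "polyfun (lform l)"
  unfolding lform_def by (intro polyfun_sum polyfun_mult polyfun_const polyfun_coord)

text \<open>If \<open>f\<close> vanishes on the grid, one coordinate after the other can be freed: the restriction to a
  line in that direction has more than \<open>D\<close> zeros.\<close>

lemma coordpoly_grid:
  fixes f :: "'a::idom ^ 'n::finite \<Rightarrow> 'a"
  assumes f: "coordpoly D f" and x: "f x \<noteq> 0"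
    and S: "\<And>i. finite (S i)" "\<And>i. D < card (S i)"
  obtains s where "\<And>i. s $ i \<in> S i" "f s \<noteq> 0"
proof (rule ccontr)
  assume *: "\<not> thesis"
  have "\<forall>y. (\<forall>i. i \<notin> A \<longrightarrow> y $ i \<in> S i) \<longrightarrow> f y = 0" for A :: "'n set"
  proof (induction A rule: infinite_finite_induct)
    case empty
    then show ?case using * that by auto
  next
    case (insert i A)
    show ?case
    proof (intro allI impI)
      fix y assume y: "\<forall>j. j \<notin> insert i A \<longrightarrow> y $ j \<in> S j"
      obtain q where q: "degree q \<le> D" "\<And>s. f (\<chi> j. if j = i then s else y $ j) = poly q s"
        using f unfolding coordpoly_def by metis
      have "S i \<subseteq> {s. poly q s = 0}"
      proof
        fix s assume "s \<in> S i"
        then have "f (\<chi> j. if j = i then s else y $ j) = 0"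
          using y by (intro insert.IH[rule_format]) auto
        then show "s \<in> {s. poly q s = 0}" by (simp add: q)
      qed
      have "q = 0"
      proof (rule ccontr)
        assume "q \<noteq> 0"
        then have "card (S i) \<le> card {s. poly q s = 0}" "card {s. poly q s = 0} \<le> degree q"
          using \<open>S i \<subseteq> _\<close> by (auto intro!: card_mono poly_roots_finite card_poly_roots_bound)
        with q(1) S(2)[of i] show False by simp
      qed
      moreover have "(\<chi> j. if j = i then y $ i else y $ j) = y" by (simp add: vec_eq_iff)
      ultimately show "f y = 0" using q(2)[of "y $ i"] by simp
    qed
  qed simp
  from this[of UNIV] x show False by simp
qed

section \<open>Evaluation of forms\<close>

lemma meval_superset:
  assumes "finite A" "Poly_Mapping.keys G \<subseteq> A" "h 0 = 0"
  shows "meval h G x = (\<Sum>m\<in>A. h (Poly_Mapping.lookup G m) * (\<Prod>i\<in>UNIV. (x $ i) ^ Poly_Mapping.lookup m i))"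
  unfolding meval_def using assms
  by (intro sum.mono_neutral_left) (auto simp: in_keys_iff)

lemma meval_of_rat_add:
  "meval of_rat (G + H) x = meval of_rat G x + (meval of_rat H x :: 'a::field_char_0)"
proof -
  let ?A = "Poly_Mapping.keys G \<union> Poly_Mapping.keys H"
  show ?thesis
    by (simp add: meval_superset[of ?A] keys_add lookup_add of_rat_add algebra_simps sum.distrib)
qed

lemma meval_of_rat_sum:
  "meval of_rat (\<Sum>i\<in>I. G i) x = (\<Sum>i\<in>I. meval of_rat (G i) x :: 'a::field_char_0)"
  by (induction I rule: infinite_finite_induct) (auto simp: meval_of_rat_add, auto simp: meval_def)

lemma meval_single:
  "meval of_rat (Poly_Mapping.single m c) x
    = (of_rat c * (\<Prod>i\<in>UNIV. x $ i ^ Poly_Mapping.lookup m i) :: 'a::field_char_0)"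
  by (simp add: meval_superset[of "{m}"])

lemma meval_scale:
  assumes "homogeneous d G"
  shows "meval h G (c *s x) = c ^ d * meval h G x"
  unfolding meval_def sum_distrib_left
proof (rule sum.cong)
  fix m assume "m \<in> Poly_Mapping.keys G"
  then have "(\<Sum>i\<in>UNIV. Poly_Mapping.lookup m i) = d"
    using assms by (auto simp: homogeneous_def)
  then have "c ^ d = (\<Prod>i\<in>UNIV. c ^ Poly_Mapping.lookup m i)"
    by (metis power_sum)
  then show "h (Poly_Mapping.lookup G m) * (\<Prod>i\<in>UNIV. (c *s x) $ i ^ Poly_Mapping.lookup m i)
      = c ^ d * (h (Poly_Mapping.lookup G m) * (\<Prod>i\<in>UNIV. x $ i ^ Poly_Mapping.lookup m i))"
    by (simp add: power_mult_distrib prod.distrib)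
qed simp

lemma vanishes_at_abs_ppoint:
  assumes "homogeneous d G" "x \<noteq> 0"
  shows "vanishes_at h G (abs_ppoint x) \<longleftrightarrow> meval h G x = 0"
proof
  assume "meval h G x = 0"
  show "vanishes_at h G (abs_ppoint x)"
    unfolding vanishes_at_def
  proof (intro allI impI)
    fix y assume "y \<noteq> 0 \<and> abs_ppoint y = abs_ppoint x"
    then have "proj_rel x y" using abs_ppoint_eq_iff[OF assms(2), of y] by metis
    then obtain c where "y = c *s x" by (auto simp: proj_rel_def)
    then show "meval h G y = 0"
      using assms(1) \<open>meval h G x = 0\<close> by (simp add: meval_scale)
  qed
qed (use assms in \<open>auto simp: vanishes_at_def\<close>)

lemma abs_ppoint_scale:
  assumes "c \<noteq> 0" "x \<noteq> 0"
  shows "abs_ppoint (c *s x) = abs_ppoint x"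
proof -
  have "c *s x \<noteq> 0" using assms by (auto simp: vec_eq_iff)
  moreover from this have "proj_rel x (c *s x)"
    using assms by (auto simp: proj_rel_def)
  ultimately show ?thesis using abs_ppoint_eq_iff[of x "c *s x"] assms by simp
qed

lemma ppoint_cases:
  obtains x where "x \<noteq> 0" "P = abs_ppoint x"
  using rep_ppoint_nonzero Quotient3_abs_rep[OF Quotient3_ppoint] by metis

definition form_product :: "int ^ 'n::finite \<Rightarrow> int ^ 'n \<Rightarrow> ('n, rat) mpoly" where
  "form_product a b = (\<Sum>i\<in>UNIV. \<Sum>j\<in>UNIV.
     Poly_Mapping.single (Poly_Mapping.single i 1 + Poly_Mapping.single j 1) (of_int (a $ i * b $ j)))"

lemma homogeneous_form_product: "homogeneous 2 (form_product a b)"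
  unfolding homogeneous_def
proof
  fix m assume "m \<in> Poly_Mapping.keys (form_product a b)"
  then obtain i j where "m = Poly_Mapping.single i 1 + Poly_Mapping.single j 1"
    unfolding form_product_def by (force dest!: subsetD[OF keys_sum] split: if_splits)
  then show "(\<Sum>k\<in>UNIV. Poly_Mapping.lookup m k) = 2"
    by (simp add: lookup_add lookup_single when_def sum.distrib)
qed

lemma meval_form_product:
  "meval of_rat (form_product a b) x
    = lform a x * (lform b x :: 'a::field_char_0)"
proof -
  have s: "(\<Prod>k\<in>UNIV. x $ k ^ Poly_Mapping.lookup (Poly_Mapping.single i 1) k) = x $ i" for i
  proof -
    have "(\<Prod>k\<in>UNIV. x $ k ^ Poly_Mapping.lookup (Poly_Mapping.single i 1) k)
        = (\<Prod>k\<in>UNIV. if k = i then x $ k else 1)"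
      by (rule prod.cong) (auto simp: lookup_single when_def)
    then show ?thesis by simp
  qed
  have "(\<Prod>k\<in>UNIV. x $ k ^ Poly_Mapping.lookup (Poly_Mapping.single i 1 + Poly_Mapping.single j 1) k)
      = x $ i * x $ j" for i j
    by (simp add: lookup_add power_add prod.distrib s del: One_nat_def)
  then show ?thesis
    by (simp add: form_product_def meval_of_rat_sum meval_single lform_def of_rat_mult sum_product mult_ac
        del: One_nat_def)
qed

lemma polyfun_meval: "(\<And>i. polyfun (\<lambda>x. g x $ i)) \<Longrightarrow> polyfun (\<lambda>x. meval h G (g x))"
  unfolding meval_def
  by (intro polyfun_sum polyfun_mult polyfun_const polyfun_prod polyfun_power)

lemma rat_point_abs_ppoint:
  assumes "x \<noteq> 0"
  shows "(rat_point (abs_ppoint x) :: ('a::field_char_0, 'n::finite) ppoint) = abs_ppoint (\<chi> i. of_rat (x $ i))"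
proof -
  have "proj_rel x x"
    using assms unfolding proj_rel_def by (auto intro!: exI[of _ 1])
  then show ?thesis by (rule rat_point.abs_eq)
qed

section \<open>Integer approximation in the completion\<close>

locale abs_value =
  fixes av :: "'k::field_char_0 \<Rightarrow> real"
  assumes nonneg: "0 \<le> av x"
    and eq_0_iff: "av x = 0 \<longleftrightarrow> x = 0"
    and mult: "av (x * y) = av x * av y"
    and triangle: "av (x + y) \<le> av x + av y"
begin

lemma one: "av 1 = 1"
  using mult[of 1 1] eq_0_iff[of 1] by simp

lemma minus: "av (- x) = av x"
proof -
  have "av (- 1) * av (- 1) = 1"
    using mult[of "- 1" "- 1"] one by simp
  then have "av (- 1) = 1"
    using nonneg[of "- 1"] by (metis abs_of_nonneg power2_eq_1_iff power2_eq_square abs_neg_one)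
  then show ?thesis using mult[of "- 1" x] by simp
qed

lemma triangle_diff: "av (x - y) \<le> av x + av y"
  using triangle[of x "- y"] minus by simp

lemma sum_le: "av (\<Sum>i\<in>I. f i) \<le> (\<Sum>i\<in>I. av (f i))"
proof (induction I rule: infinite_finite_induct)
  case (insert i I)
  then show ?case using triangle[of "f i" "\<Sum>i\<in>I. f i"] by simp
qed (use eq_0_iff[of 0] in auto)

lemma power: "av (x ^ n) = av x ^ n"
  by (induction n) (auto simp: one mult)

end

lemma completion_abs_value: "completion_of_rat \<nu> av \<Longrightarrow> abs_value av"
  by unfold_locales (simp_all add: completion_of_rat_def)

lemma padic_abs_of_int:
  "u \<noteq> 0 \<Longrightarrow> padic_abs p (of_int u) = real p powi (- int (multiplicity (int p) u))"
  by (simp add: padic_abs_def)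

text \<open>A rational \<open>r = a / b\<close> close to \<open>x\<close> is a \<open>p\<close>-adic integer, so \<open>b\<close> is invertible modulo \<open>p\<^sup>m\<close> and the
  solutions \<open>s\<close> of \<open>b s = a\<close> modulo \<open>p\<^sup>m\<close> are as close to \<open>r\<close> as required; \<open>D + 1\<close> of them lie
  in an interval of length \<open>(D + 1) p\<^sup>m\<close>.\<close>

lemma padic_integer_approximation:
  fixes av :: "'k::field_char_0 \<Rightarrow> real"
  assumes p: "prime p" and K: "completion_of_rat (padic_abs p) av" and x: "av x \<le> 1"
  obtains S :: "int set" where "finite S" "card S = D + 1"
    "\<And>s. s \<in> S \<Longrightarrow> \<bar>s\<bar> \<le> int (D + 1) * int p ^ m \<and> av (of_int s - x) \<le> 2 / real p ^ m"
proof -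
  interpret abs_value av using K by (rule completion_abs_value)
  have av_rat: "av (of_rat r) = padic_abs p r" for r
    using K by (auto simp: completion_of_rat_def)
  then have av_int: "av (of_int u) = real p powi (- int (multiplicity (int p) u))" if "u \<noteq> 0" for u
    using padic_abs_of_int[OF that] by (metis of_rat_of_int_eq)
  have p2: "p \<ge> 2" using p by (rule prime_ge_2_nat)
  have pp: "prime (int p)" using p by simp
  have le1: "av (of_int u) \<le> 1" for u
  proof (cases "u = 0")
    case False
    then show ?thesis
      using p2 by (simp add: av_int power_int_minus inverse_le_1_iff one_le_power)
  qed (use eq_0_iff[of 0] in simp)
  have avp: "av (of_int (int p)) = 1 / real p"
    using p2 pp by (simp add: av_int power_int_minus field_simps del: of_int_of_nat_eq)
  have small: "av (of_int u) \<le> 1 / real p ^ m" if "int p ^ m dvd u" for u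
  proof -
    obtain k where "u = int p ^ m * k" using \<open>int p ^ m dvd u\<close> by blast
    then have "av (of_int u) = (1 / real p) ^ m * av (of_int k)"
      by (simp only: of_int_mult of_int_power mult power avp)
    also have "\<dots> \<le> (1 / real p) ^ m * 1"
      by (intro mult_left_mono le1) auto
    finally show ?thesis by (simp add: power_divide)
  qed
  have "\<exists>r. av (x - of_rat r) < 1 / real p ^ m"
    using K p2 unfolding completion_of_rat_def by simp
  then obtain r where r: "av (x - of_rat r) < 1 / real p ^ m" by blast
  obtain a b where ab: "quotient_of r = (a, b)" by (cases "quotient_of r")
  note b = quotient_of_denom_pos[OF ab] and cop = quotient_of_coprime[OF ab]
  have r_eq: "of_rat r * of_int b = (of_int a :: 'k)"
  proof -
    have "r * of_int b = of_int a" using quotient_of_div[OF ab] b by simp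
    then show ?thesis by (metis of_rat_mult of_rat_of_int_eq)
  qed
  \<comment> \<open>The value of \<open>r\<close> is a power of \<open>p\<close> below \<open>2\<close>, hence at most \<open>1\<close>.\<close>
  have "av (of_rat r) < 2"
  proof -
    have "av (of_rat r) \<le> av x + av (x - of_rat r)"
      using triangle_diff[of x "x - of_rat r"] by simp
    also have "\<dots> < 1 + 1 / real p ^ m" using x r by simp
    also have "\<dots> \<le> 2" using p2 by simp
    finally show ?thesis .
  qed
  have ndvd: "\<not> int p dvd b"
  proof
    assume pb: "int p dvd b"
    then have "\<not> int p dvd a"
      using cop pp by (meson coprime_common_divisor not_prime_unit)
    then have "a \<noteq> 0" "multiplicity (int p) a = 0"
      by (auto simp: not_dvd_imp_multiplicity_0)
    moreover have "multiplicity (int p) b \<ge> 1"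
      using pb b pp by (intro multiplicity_geI) auto
    moreover have "r \<noteq> 0" using \<open>a \<noteq> 0\<close> quotient_of_div[OF ab] b by simp
    ultimately have "av (of_rat r) = real p ^ multiplicity (int p) b"
      using ab by (simp add: av_rat padic_abs_def)
    also have "\<dots> \<ge> real p ^ 1"
      using p2 \<open>multiplicity (int p) b \<ge> 1\<close> by (intro power_increasing) auto
    finally show False using \<open>av (of_rat r) < 2\<close> p2 by simp
  qed
  then have avb: "av (of_int b) = 1"
    using b by (simp add: av_int not_dvd_imp_multiplicity_0)
  have "coprime b (int p ^ m)"
    using prime_imp_coprime[OF pp ndvd] by (simp add: coprime_commute)
  then obtain u v where uv: "u * b + v * int p ^ m = 1"
    using bezout_int[of b "int p ^ m"] by auto
  define s0 where "s0 = (u * a) mod (int p ^ m)"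
  have s0: "0 \<le> s0" "s0 < int p ^ m" using p2 by (auto simp: s0_def)
  define S where "S = (\<lambda>w. s0 + int p ^ m * w) ` {0..int D}"
  have "inj_on (\<lambda>w. s0 + int p ^ m * w) {0..int D}"
    using p2 by (auto simp: inj_on_def)
  then have "card S = D + 1" by (simp add: S_def card_image)
  moreover have "\<bar>s\<bar> \<le> int (D + 1) * int p ^ m \<and> av (of_int s - x) \<le> 2 / real p ^ m"
    if "s \<in> S" for s
  proof
    obtain w where w: "0 \<le> w" "w \<le> int D" and s: "s = s0 + int p ^ m * w"
      using \<open>s \<in> S\<close> by (auto simp: S_def)
    have "int p ^ m * w \<le> int p ^ m * int D" using w by (intro mult_left_mono) auto
    then show "\<bar>s\<bar> \<le> int (D + 1) * int p ^ m"
      using s0 w by (simp add: s algebra_simps)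
    obtain k where k: "s0 = u * a - int p ^ m * k"
      by (metis s0_def minus_mult_div_eq_mod)
    have "b * s - a = (u * b + v * int p ^ m - 1) * a + int p ^ m * (b * (w - k) - v * a)"
      by (simp add: s k algebra_simps)
    then have "int p ^ m dvd b * s - a" by (simp add: uv)
    then have "av (of_int (b * s - a)) \<le> 1 / real p ^ m" by (rule small)
    moreover have "of_int (b * s - a) = of_int b * (of_int s - of_rat r :: 'k)"
      using r_eq by (simp add: algebra_simps)
    ultimately have "av (of_int s - of_rat r) \<le> 1 / real p ^ m"
      by (simp add: mult avb)
    moreover have "av (of_int s - x) \<le> av (of_int s - of_rat r) + av (x - of_rat r)"
      using triangle_diff[of "of_int s - of_rat r" "x - of_rat r"] by simp
    ultimately show "av (of_int s - x) \<le> 2 / real p ^ m" using r by simp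
  qed
  ultimately show thesis using that[of S] by (simp add: S_def)
qed

text \<open>The integers are \<open>D + 1\<close> consecutive ones, the first obtained by rounding down \<open>m r\<close> for a
  rational \<open>r\<close> close to \<open>x\<close>; the error grows with \<open>D\<close>, which stays fixed while \<open>m\<close> tends to infinity.\<close>

lemma real_integer_approximation:
  fixes av :: "'k::field_char_0 \<Rightarrow> real"
  assumes K: "completion_of_rat (\<lambda>r. \<bar>of_rat r\<bar>) av" and x: "av x \<le> 1" and m: "m \<ge> (1::nat)"
  obtains S :: "int set" where "finite S" "card S = D + 1"
    "\<And>s. s \<in> S \<Longrightarrow> \<bar>of_int s\<bar> \<le> real (D + 3) * real m
        \<and> av (of_rat (1 / of_nat m) * of_int s - x) \<le> real (D + 3) / real m"
proof -
  interpret abs_value av using K by (rule completion_abs_value)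
  have av_rat: "av (of_rat r) = \<bar>of_rat r\<bar>" for r
    using K by (auto simp: completion_of_rat_def)
  have "\<exists>r. av (x - of_rat r) < 1 / real m"
    using K m unfolding completion_of_rat_def by simp
  then obtain r where r: "av (x - of_rat r) < 1 / real m" by blast
  have r2: "\<bar>of_rat r :: real\<bar> \<le> 2"
  proof -
    have "av (of_rat r) \<le> av x + av (x - of_rat r)"
      using triangle_diff[of x "x - of_rat r"] by simp
    also have "\<dots> \<le> 1 + 1 / real m" using x r by simp
    also have "\<dots> \<le> 2" using m by simp
    finally show ?thesis by (simp add: av_rat)
  qed
  define s0 where "s0 = \<lfloor>real m * of_rat r\<rfloor>"
  have "\<bar>of_int s\<bar> \<le> real (D + 3) * real m
        \<and> av (of_rat (1 / of_nat m) * of_int s - x) \<le> real (D + 3) / real m"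
    if s: "s \<in> {s0..s0 + int D}" for s
  proof
    have "real_of_int s0 \<le> real m * of_rat r" "real m * of_rat r < real_of_int s0 + 1"
      by (auto simp: s0_def)
    moreover have "real_of_int s0 \<le> of_int s" "real_of_int s \<le> of_int s0 + real D"
      using s by auto
    ultimately have d: "\<bar>of_int s - real m * of_rat r\<bar> \<le> real D + 1" by linarith
    have "\<bar>real m * of_rat r\<bar> \<le> real m * 2"
      unfolding abs_mult using r2 by (simp add: mult_left_mono)
    with d have "\<bar>of_int s\<bar> \<le> real D + 1 + real m * 2" by linarith
    also have "\<dots> \<le> (real D + 1) * real m + real m * 2"
      using m mult_left_mono[of 1 "real m" "real D + 1"] by simp
    finally show "\<bar>of_int s\<bar> \<le> real (D + 3) * real m" by (simp add: algebra_simps)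
    have "av (of_rat (1 / of_nat m) * of_int s - of_rat r) = av (of_rat (of_int s / of_nat m - r))"
      by (simp add: of_rat_diff of_rat_divide)
    also have "\<dots> = \<bar>(of_int s - real m * of_rat r) / real m\<bar>"
      unfolding av_rat using m by (simp add: of_rat_diff of_rat_divide diff_divide_distrib)
    also have "\<dots> \<le> (real D + 1) / real m"
      unfolding abs_divide using d m by (simp add: divide_right_mono)
    finally have "av (of_rat (1 / of_nat m) * of_int s - of_rat r) \<le> (real D + 1) / real m" .
    moreover have "av (of_rat (1 / of_nat m) * of_int s - x)
        \<le> av (of_rat (1 / of_nat m) * of_int s - of_rat r) + av (x - of_rat r)"
      using triangle_diff[of "of_rat (1 / of_nat m) * of_int s - of_rat r" "x - of_rat r"] by simp
    ultimately have "av (of_rat (1 / of_nat m) * of_int s - x) \<le> (real D + 1) / real m + 1 / real m"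
      using r by simp
    also have "\<dots> \<le> real (D + 3) / real m"
      by (simp add: divide_right_mono flip: add_divide_distrib)
    finally show "av (of_rat (1 / of_nat m) * of_int s - x) \<le> real (D + 3) / real m" .
  qed
  then show thesis using that[of "{s0..s0 + int D}"] by simp
qed

text \<open>The scale \<open>c\<close> is \<open>1 / N\<close> at the real place and \<open>1\<close> at the \<open>p\<close>-adic ones.  It does not depend on \<open>x\<close>,
  so that coordinatewise approximations of a vector combine to an integer vector, with the
  same projective point as its multiple by \<open>c\<close>.\<close>

lemma integer_approximation:
  fixes av :: "'k::field_char_0 \<Rightarrow> real"
  assumes \<nu>: "place \<nu>" and K: "completion_of_rat \<nu> av"
  obtains N :: real and c :: rat where "N \<ge> M" "N \<ge> 1" "c \<noteq> 0"
    "\<And>x. av x \<le> 1 \<Longrightarrow> \<exists>S :: int set. finite S \<and> card S = D + 1 \<and>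
       (\<forall>s\<in>S. \<bar>of_int s\<bar> \<le> real (D + 3) * N \<and> av (of_rat c * of_int s - x) \<le> real (D + 3) / N)"
  using \<nu> unfolding place_def
proof (elim disjE exE conjE)
  assume inf: "\<nu> = (\<lambda>r. \<bar>of_rat r\<bar>)"
  define m where "m = max 1 (nat \<lceil>M\<rceil>)"
  have m: "m \<ge> 1" "real m \<ge> M" using real_nat_ceiling_ge[of M] by (auto simp: m_def)
  show thesis
  proof (rule that[of "real m" "1 / of_nat m"])
    fix x assume x: "av x \<le> 1"
    show "\<exists>S :: int set. finite S \<and> card S = D + 1 \<and>
       (\<forall>s\<in>S. \<bar>of_int s\<bar> \<le> real (D + 3) * real m \<and>
         av (of_rat (1 / of_nat m) * of_int s - x) \<le> real (D + 3) / real m)"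
      by (rule real_integer_approximation[OF K[unfolded inf] x m(1), of D]) blast
  qed (use m in auto)
next
  fix p assume p: "prime p" and fin: "\<nu> = padic_abs p"
  have p2: "p \<ge> 2" using p by (rule prime_ge_2_nat)
  obtain m where m: "M < real p ^ m"
    using real_arch_pow[of "real p" M] p2 by auto
  show thesis
  proof (rule that[of "real p ^ m" 1])
    fix x assume x: "av x \<le> 1"
    obtain S :: "int set" where S: "finite S" "card S = D + 1"
      "\<And>s. s \<in> S \<Longrightarrow> \<bar>s\<bar> \<le> int (D + 1) * int p ^ m \<and> av (of_int s - x) \<le> 2 / real p ^ m"
      by (rule padic_integer_approximation[OF p K[unfolded fin] x, of D m]) blast
    have "\<bar>of_int s\<bar> \<le> real (D + 3) * real p ^ m \<and> av (of_rat 1 * of_int s - x) \<le> real (D + 3) / real p ^ m"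
      if "s \<in> S" for s
    proof
      have "real_of_int \<bar>s\<bar> \<le> of_int (int (D + 1) * int p ^ m)"
        using S(3)[OF that] by (simp only: of_int_le_iff)
      also have "\<dots> = real (D + 1) * real p ^ m" by simp
      also have "\<dots> \<le> real (D + 3) * real p ^ m" by (intro mult_right_mono) auto
      finally show "\<bar>of_int s\<bar> \<le> real (D + 3) * real p ^ m" by simp
      have "2 / real p ^ m \<le> real (D + 3) / real p ^ m" by (intro divide_right_mono) auto
      then show "av (of_rat 1 * of_int s - x) \<le> real (D + 3) / real p ^ m"
        using S(3)[OF that] by simp
    qed
    then show "\<exists>S :: int set. finite S \<and> card S = D + 1 \<and>
       (\<forall>s\<in>S. \<bar>of_int s\<bar> \<le> real (D + 3) * real p ^ m \<and>
         av (of_rat 1 * of_int s - x) \<le> real (D + 3) / real p ^ m)"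
      using S(1,2) by blast
  qed (use m p2 in auto)
qed

section \<open>Estimates near \<open>Q\<^sub>0\<close>\<close>

text \<open>For nonzero vectors, equality of projective points, expressed by the vanishing of the minors that occur in \<open>pdist\<close>.\<close>

definition parallel :: "'a::comm_ring_1 ^ 'n \<Rightarrow> 'a ^ 'n \<Rightarrow> bool" where
  "parallel x y \<longleftrightarrow> (\<forall>i j. x $ i * y $ j = x $ j * y $ i)"

lemma parallel_imp_multiple:
  fixes x y :: "'a::field ^ 'n"
  assumes "parallel x y" "y \<noteq> 0"
  obtains c where "x = c *s y"
proof -
  obtain j where j: "y $ j \<noteq> 0" using assms(2) by (auto simp: vec_eq_iff)
  have "x = (x $ j / y $ j) *s y"
    using assms(1) j by (auto simp: vec_eq_iff parallel_def field_simps)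
  then show thesis by (rule that)
qed

definition coeff_bound :: "('n::finite, int) mpoly \<Rightarrow> ('k::ring_1 \<Rightarrow> real) \<Rightarrow> real" where
  "coeff_bound F av = 2 * (\<Sum>m\<in>Poly_Mapping.keys F. av (of_int (Poly_Mapping.lookup F m)))"

context abs_value
begin

lemma coeff_bound_nonneg: "coeff_bound F av \<ge> 0"
  by (simp add: coeff_bound_def sum_nonneg nonneg)

lemma qbil_le:
  assumes X: "\<And>i. av (x $ i) \<le> X" and Y: "\<And>i. av (y $ i) \<le> Y"
  shows "av (qbil F x y) \<le> coeff_bound F av * X * Y"
proof -
  have XY: "0 \<le> X" "0 \<le> Y" using X Y nonneg by (meson order_trans)+
  have p: "av (x $ i * y $ j) \<le> X * Y" for i j
    unfolding mult using X Y XY by (intro mult_mono nonneg) auto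
  have "av (qbil F x y) \<le> (\<Sum>m\<in>Poly_Mapping.keys F. av (of_int (Poly_Mapping.lookup F m)) * (2 * X * Y))"
    unfolding qbil_def
  proof (rule order_trans[OF sum_le], rule sum_mono, subst mult, rule mult_left_mono[OF _ nonneg])
    fix m
    show "av (x $ fst (quad_pair m) * y $ snd (quad_pair m) + y $ fst (quad_pair m) * x $ snd (quad_pair m))
        \<le> 2 * X * Y"
      using p[of "fst (quad_pair m)" "snd (quad_pair m)"] p[of "snd (quad_pair m)" "fst (quad_pair m)"]
      by (intro order_trans[OF triangle]) (simp add: algebra_simps)
  qed
  then show ?thesis by (simp add: coeff_bound_def sum_distrib_left sum_distrib_right mult_ac)
qed

lemma qform_le:
  assumes X: "\<And>i. av (x $ i) \<le> X"
  shows "av (qform F x) \<le> coeff_bound F av * X * X"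
proof -
  have X0: "0 \<le> X" using X nonneg by (meson order_trans)
  have p: "av (x $ i * x $ j) \<le> X * X" for i j
    unfolding mult using X X0 by (intro mult_mono nonneg) auto
  have "av (qform F x) \<le> (\<Sum>m\<in>Poly_Mapping.keys F. av (of_int (Poly_Mapping.lookup F m)) * (X * X))"
    unfolding qform_def
    by (rule order_trans[OF sum_le], rule sum_mono, subst mult, rule mult_left_mono[OF p nonneg])
  also have "\<dots> \<le> coeff_bound F av * (X * X)"
    unfolding coeff_bound_def sum_distrib_right[symmetric]
    by (rule mult_right_mono) (auto simp: sum_nonneg nonneg)
  finally show ?thesis by (simp add: mult.assoc)
qed

lemma max_coord_pos:
  assumes "x \<noteq> 0"
  shows "0 < Max (range (\<lambda>i. av (x $ i)))"
proof -
  obtain i where "x $ i \<noteq> 0" using assms by (auto simp: vec_eq_iff)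
  then have "0 < av (x $ i)" using nonneg eq_0_iff by (metis less_eq_real_def)
  also have "\<dots> \<le> Max (range (\<lambda>i. av (x $ i)))" by (intro Max_ge) auto
  finally show ?thesis .
qed

lemma pdist_pos:
  assumes "completion_of_rat \<nu> av" "x \<noteq> 0" "y \<noteq> 0" "\<not> parallel x y"
  shows "0 < pdist av (abs_ppoint x) (abs_ppoint y)"
proof -
  obtain i j where "x $ i * y $ j - x $ j * y $ i \<noteq> 0"
    using assms(4) by (auto simp: parallel_def)
  then have "0 < av (x $ i * y $ j - x $ j * y $ i)"
    using nonneg eq_0_iff by (metis less_eq_real_def)
  also have "\<dots> \<le> Max (range (\<lambda>(i, j). av (x $ i * y $ j - x $ j * y $ i)))"
    by (intro Max_ge) auto
  finally show ?thesis
    using assms by (simp add: pdist_abs_ppoint max_coord_pos)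
qed

text \<open>Put \<open>t = q + d\<close>.  As \<open>F(q) = 0\<close>, the value \<open>F(t)\<close> is \<open>O(e)\<close>, and \<open>\<phi>(t)\<close> is
  \<open>- B(p,t) t\<close> up to \<open>O(e)\<close>, where \<open>t\<close> is \<open>q\<close> up to \<open>e\<close>.  So the minors of
  \<open>\<phi>(t)\<close> and \<open>q\<close> are \<open>O(e)\<close>, while the coordinate of \<open>\<phi>(t)\<close> at \<open>j\<close> stays close to \<open>- B(p,q)\<close>, hence
  away from zero.\<close>

lemma stereo_estimate:
  assumes K: "completion_of_rat \<nu> av"
    and q: "qform F q = 0" "q $ j = 1" "\<And>i. av (q $ i) \<le> 1"
    and B: "qbil F p q \<noteq> 0"
  obtains C e0 where "0 \<le> C" "0 < e0" "\<And>e t. \<lbrakk>0 \<le> e; e \<le> e0; \<And>i. av (t $ i - q $ i) \<le> e\<rbrakk>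
     \<Longrightarrow> pdist av (abs_ppoint (stereo F p t)) (abs_ppoint q) \<le> C * e"
proof -
  define P where "P = Max (range (\<lambda>i. av (p $ i)))"
  have P: "av (p $ i) \<le> P" for i unfolding P_def by (intro Max_ge) auto
  have P0: "P \<ge> 0" using P nonneg by (meson order_trans)
  define c where "c = coeff_bound F av"
  have c0: "c \<ge> 0" unfolding c_def by (rule coeff_bound_nonneg)
  define \<beta> where "\<beta> = av (qbil F p q)"
  have \<beta>0: "\<beta> > 0" unfolding \<beta>_def using B nonneg eq_0_iff by (metis less_eq_real_def)
  define A1 where "A1 = 2 * c * (2 * P) + c * P * 2 * 2"
  define A2 where "A2 = 2 * c * P + (c * P + c * P * 2)"
  have A: "A1 \<ge> 0" "A2 \<ge> 0" using P0 c0 by (auto simp: A1_def A2_def)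
  \<comment> \<open>\<open>A1 * e\<close> bounds the minors and \<open>A2 * e\<close> the distance of the coordinate \<open>j\<close> from \<open>- B(p,q)\<close>,
    which \<open>e0\<close> keeps below \<open>\<beta> / 2\<close>.\<close>
  define e0 where "e0 = min 1 (\<beta> / (2 * (A2 + 1)))"
  have e0: "e0 > 0" using \<beta>0 A by (simp add: e0_def)
  have q0: "q \<noteq> 0" using q(2) by auto
  have "pdist av (abs_ppoint (stereo F p t)) (abs_ppoint q) \<le> (2 * A1 / \<beta>) * e"
    if e: "0 \<le> e" "e \<le> e0" and t: "\<And>i. av (t $ i - q $ i) \<le> e" for e t
  proof -
    define d where "d = t - q"
    have d: "av (d $ i) \<le> e" for i using t by (simp add: d_def)
    have tq: "t = q + d" by (simp add: d_def)
    have e1: "e \<le> 1" using e by (simp add: e0_def)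
    have t2: "av (t $ i) \<le> 2" for i
      using triangle[of "q $ i" "d $ i"] q(3)[of i] d[of i] e1 by (simp add: tq)
    have Ft: "av (qform F t) \<le> 2 * c * e"
    proof -
      have "av (qform F t) \<le> av (qbil F q d) + av (qform F d)"
        unfolding tq qform_add q(1) using triangle[of "qform F d" "qbil F q d"] by simp
      also have "\<dots> \<le> c * 1 * e + c * e * e"
        unfolding c_def by (intro add_mono qbil_le qform_le q d)
      also have "c * e * e \<le> c * e * 1" using c0 e e1 by (intro mult_left_mono) auto
      finally show ?thesis by (simp add: algebra_simps)
    qed
    have Bt: "av (qbil F p t) \<le> c * P * 2"
      unfolding c_def by (intro qbil_le P t2)
    have Bd: "av (qbil F p d) \<le> c * P * e"
      unfolding c_def by (intro qbil_le P d)
    define z where "z = stereo F p t"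
    have minor: "av (z $ i * q $ k - z $ k * q $ i) \<le> A1 * e" for i k
    proof -
      have "z $ i * q $ k - z $ k * q $ i
          = qform F t * (p $ i * q $ k - p $ k * q $ i) - qbil F p t * (d $ i * q $ k - d $ k * q $ i)"
        by (simp add: z_def tq algebra_simps)
      then have "av (z $ i * q $ k - z $ k * q $ i)
          \<le> av (qform F t) * av (p $ i * q $ k - p $ k * q $ i)
            + av (qbil F p t) * av (d $ i * q $ k - d $ k * q $ i)"
        using triangle_diff by (metis mult)
      also have "\<dots> \<le> (2 * c * e) * (2 * P) + (c * P * 2) * (2 * e)"
      proof (intro add_mono mult_mono Ft Bt nonneg)
        have w: "av (x $ i * q $ k - x $ k * q $ i) \<le> 2 * W" if "\<And>i. av (x $ i) \<le> W" for x W
        proof -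
          have W: "0 \<le> W" using that nonneg by (meson order_trans)
          have "av (x $ i * q $ k - x $ k * q $ i) \<le> av (x $ i) * av (q $ k) + av (x $ k) * av (q $ i)"
            using triangle_diff by (metis mult)
          also have "\<dots> \<le> W * 1 + W * 1" by (intro add_mono mult_mono that q nonneg W)
          finally show ?thesis by simp
        qed
        show "av (p $ i * q $ k - p $ k * q $ i) \<le> 2 * P" by (rule w[OF P])
        show "av (d $ i * q $ k - d $ k * q $ i) \<le> 2 * e" by (rule w[OF d])
      qed (use c0 P0 e in auto)
      finally show ?thesis by (simp add: A1_def algebra_simps)
    qed
    have zj: "av (z $ j) \<ge> \<beta> / 2"
    proof -
      have "z $ j + qbil F p q = qform F t * p $ j - (qbil F p d + qbil F p t * d $ j)"
        by (simp add: z_def tq q(2) qbil_add_right algebra_simps)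
      then have "av (z $ j + qbil F p q) \<le> av (qform F t) * av (p $ j) + av (qbil F p d + qbil F p t * d $ j)"
        using triangle_diff by (metis mult)
      also have "av (qbil F p d + qbil F p t * d $ j) \<le> av (qbil F p d) + av (qbil F p t) * av (d $ j)"
        using triangle by (metis mult)
      also have "av (qform F t) * av (p $ j) + (av (qbil F p d) + av (qbil F p t) * av (d $ j))
          \<le> (2 * c * e) * P + (c * P * e + (c * P * 2) * e)"
        by (intro add_mono mult_mono Ft Bd Bt P d nonneg) (use c0 P0 e in auto)
      also have "\<dots> = A2 * e" by (simp add: A2_def algebra_simps)
      also have "\<dots> \<le> (A2 + 1) * (\<beta> / (2 * (A2 + 1)))"
        using A e by (intro mult_mono) (auto simp: e0_def)
      also have "\<dots> = \<beta> / 2" using A by (simp add: field_simps)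
      finally have "av (z $ j + qbil F p q) \<le> \<beta> / 2" by simp
      moreover have "\<beta> \<le> av (z $ j + qbil F p q) + av (z $ j)"
        using triangle_diff[of "z $ j + qbil F p q" "z $ j"] by (simp add: \<beta>_def)
      ultimately show ?thesis by simp
    qed
    then have z0: "z \<noteq> 0" using \<beta>0 eq_0_iff[of 0] by auto
    have "pdist av (abs_ppoint z) (abs_ppoint q) \<le> (A1 * e) / (\<beta> / 2 * 1)"
      unfolding pdist_abs_ppoint[OF K z0 q0]
    proof (intro frac_le mult_mono mult_pos_pos)
      show "Max (range (\<lambda>(i, j). av (z $ i * q $ j - z $ j * q $ i))) \<le> A1 * e"
        using minor by (intro Max.boundedI) auto
      show "\<beta> / 2 \<le> Max (range (\<lambda>i. av (z $ i)))"
        by (rule order_trans[OF zj]) (auto intro: Max_ge)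
      have "1 = av (q $ j)" by (simp add: q one)
      also have "\<dots> \<le> Max (range (\<lambda>i. av (q $ i)))" by (intro Max_ge) auto
      finally show "1 \<le> Max (range (\<lambda>i. av (q $ i)))" .
    qed (use A e \<beta>0 zj max_coord_pos[OF z0] in auto)
    then show ?thesis by (simp add: z_def mult_ac)
  qed
  then show thesis using that[of "2 * A1 / \<beta>" e0] A \<beta>0 e0 by simp
qed

end

text \<open>Dividing an integer representative by its content only decreases its coordinates.\<close>

lemma height_le:
  fixes z :: "int ^ 'n::finite"
  assumes z: "z \<noteq> 0" and B: "\<And>i. \<bar>real_of_int (z $ i)\<bar> \<le> B"
  shows "height (abs_ppoint (ivec z)) \<le> B"
proof -
  define g where "g = Gcd (range (($) z))"
  obtain i where i: "z $ i \<noteq> 0" using z by (auto simp: vec_eq_iff)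
  have g0: "g \<noteq> 0" using i by (auto simp: g_def Gcd_0_iff)
  have g1: "g \<ge> 1"
  proof -
    have "g \<ge> 0" by (simp add: g_def)
    with g0 show ?thesis by simp
  qed
  define w where "w = (\<chi> i. z $ i div g)"
  have zw: "z $ i = g * w $ i" for i
    by (simp add: w_def g_def Gcd_dvd)
  have "Gcd (range (\<lambda>i. g * w $ i)) = normalize (g * Gcd (range (($) w)))"
    using Gcd_mult[of g "range (($) w)"] by (simp add: image_image)
  moreover have "Gcd (range (\<lambda>i. g * w $ i)) = g"
    unfolding zw[symmetric] by (simp add: g_def)
  moreover have "Gcd (range (($) w)) \<ge> 0" by simp
  ultimately have w1: "Gcd (range (($) w)) = 1"
    using g1 by (simp add: abs_mult)
  have "w \<noteq> 0" using i zw[of i] by auto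
  moreover have "(ivec z :: rat ^ 'n) = of_int g *s ivec w"
    by (simp add: vec_eq_iff zw)
  ultimately have "(abs_ppoint (ivec z) :: (rat, 'n) ppoint) = abs_ppoint (ivec w)"
    using g0 by (simp add: abs_ppoint_scale)
  then have "height (abs_ppoint (ivec z)) = of_int (Max (range (\<lambda>i. \<bar>w $ i\<bar>)))"
    using height_primitive[OF w1] by (simp add: ivec_def)
  also have "\<dots> \<le> B"
  proof -
    have "Max (range (\<lambda>i. \<bar>w $ i\<bar>)) \<in> range (\<lambda>i. \<bar>w $ i\<bar>)" by (intro Max_in) auto
    then obtain i where i: "Max (range (\<lambda>i. \<bar>w $ i\<bar>)) = \<bar>w $ i\<bar>" by (rule imageE)
    have "1 * \<bar>w $ i\<bar> \<le> g * \<bar>w $ i\<bar>" using g1 by (intro mult_right_mono) auto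
    also have "\<dots> = \<bar>z $ i\<bar>" using g1 by (simp add: zw abs_mult)
    finally have "real_of_int \<bar>w $ i\<bar> \<le> real_of_int \<bar>z $ i\<bar>" by simp
    then show ?thesis using B[of i] i by simp
  qed
  finally show ?thesis .
qed

lemma stereo_height:
  fixes p :: "int ^ 'n::finite"
  obtains C where "0 \<le> C" "\<And>T X. \<lbrakk>stereo F p T \<noteq> 0; \<And>i. \<bar>real_of_int (T $ i)\<bar> \<le> X\<rbrakk>
    \<Longrightarrow> height (abs_ppoint (ivec (stereo F p T))) \<le> C * X\<^sup>2"
proof -
  interpret abs_value "abs :: real \<Rightarrow> real"
    by unfold_locales (auto simp: abs_mult)
  define P where "P = Max (range (\<lambda>i. \<bar>real_of_int (p $ i)\<bar>))"
  have P: "\<bar>real_of_int (p $ i)\<bar> \<le> P" for i unfolding P_def by (intro Max_ge) auto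
  have P0: "P \<ge> 0" using P by (meson order_trans abs_ge_zero)
  define c where "c = coeff_bound F (abs :: real \<Rightarrow> real)"
  have c0: "c \<ge> 0" unfolding c_def by (rule coeff_bound_nonneg)
  show thesis
  proof (rule that[of "2 * c * P"])
    fix T :: "int ^ 'n" and X
    assume z: "stereo F p T \<noteq> 0" and X: "\<And>i. \<bar>real_of_int (T $ i)\<bar> \<le> X"
    have X0: "X \<ge> 0" using X by (meson order_trans abs_ge_zero)
    have F: "\<bar>qform F (ivec T)\<bar> \<le> c * X * X" unfolding c_def by (intro qform_le) (simp add: X)
    have B: "\<bar>qbil F (ivec p) (ivec T)\<bar> \<le> c * P * X"
      unfolding c_def by (intro qbil_le) (simp_all add: X P)
    show "height (abs_ppoint (ivec (stereo F p T))) \<le> 2 * c * P * X\<^sup>2"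
    proof (rule height_le[OF z])
      fix i
      have "real_of_int (stereo F p T $ i) = qform F (ivec T) * ivec p $ i - qbil F (ivec p) (ivec T) * ivec T $ i"
        by (simp add: qform_ivec qbil_ivec)
      then have "\<bar>real_of_int (stereo F p T $ i)\<bar>
          \<le> \<bar>qform F (ivec T)\<bar> * \<bar>ivec p $ i\<bar> + \<bar>qbil F (ivec p) (ivec T)\<bar> * \<bar>ivec T $ i\<bar>"
        by (metis abs_mult abs_triangle_ineq4)
      also have "\<dots> \<le> (c * X * X) * P + (c * P * X) * X"
        by (intro add_mono mult_mono F B) (use X P c0 P0 X0 in auto)
      finally show "\<bar>real_of_int (stereo F p T $ i)\<bar> \<le> 2 * c * P * X\<^sup>2"
        by (simp add: power2_eq_square algebra_simps)
    qed
  qed (use c0 P0 in simp)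
qed

section \<open>Avoiding a closed subset and the point itself\<close>

text \<open>The form \<open>l\<close> is what keeps approximations different from the point \<open>[q]\<close>.  The integer vectors
  parallel to \<open>q\<close> are rational multiples of one of them, \<open>r\<close>, if there are any besides zero; the vectors
  \<open>r\<close> and \<open>p\<close> are independent because \<open>B(p,p) = 0 \<noteq> B(p,q)\<close>, and \<open>l(x)\<close> is a minor of order three
  of the matrix with rows \<open>x\<close>, \<open>r\<close>, \<open>p\<close>.\<close>

lemma annihilating_form:
  fixes q :: "'k::field_char_0 ^ 'n::finite" and p :: "int ^ 'n"
  assumes n: "CARD('n) \<ge> 3" and p: "qform F p = 0" and pq: "qbil F (ivec p) q \<noteq> 0"
  obtains l :: "int ^ 'n" where "l \<noteq> 0" "lform l p = 0" "\<And>x :: int ^ 'n. parallel (ivec x) q \<Longrightarrow> lform l x = 0"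
proof (cases "\<exists>r :: int ^ 'n. r \<noteq> 0 \<and> parallel (ivec r) q")
  case True
  then obtain r :: "int ^ 'n" where r: "r \<noteq> 0" "parallel (ivec r) q" by blast
  have q0: "q \<noteq> 0" using pq by (auto simp: qbil_def)
  have "ivec p \<noteq> (0 :: 'k ^ 'n)" using pq by (auto simp: qbil_def)
  have "\<not> parallel r p"
  proof
    assume "parallel r p"
    then have "parallel (ivec r :: 'k ^ 'n) (ivec p)"
      unfolding parallel_def ivec_nth by (metis of_int_mult)
    then obtain c where c: "ivec r = c *s (ivec p :: 'k ^ 'n)"
      using \<open>ivec p \<noteq> 0\<close> by (rule parallel_imp_multiple)
    have "parallel q (ivec r)" using r(2) by (auto simp: parallel_def mult.commute)
    then obtain d where d: "q = d *s ivec r"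
      using r(1) by (auto elim: parallel_imp_multiple)
    have "qbil F (ivec p) q = d * c * (2 * of_int (qform F p))"
      by (simp only: d c qbil_scale_right qbil_self qform_ivec mult.assoc)
    with p pq show False by simp
  qed
  then obtain i j where ij: "r $ i * p $ j \<noteq> r $ j * p $ i" by (auto simp: parallel_def)
  then have "i \<noteq> j" by auto
  have "\<exists>k. k \<notin> {i, j}"
  proof (rule ccontr)
    assume "\<not> (\<exists>k. k \<notin> {i, j})"
    then have "CARD('n) = card {i, j}" by (intro arg_cong[where f = card]) blast
    with n show False by (simp add: \<open>i \<noteq> j\<close>)
  qed
  then obtain k where k: "k \<noteq> i" "k \<noteq> j" by auto
  \<comment> \<open>Expansion along the row \<open>x\<close> of the determinant in the columns \<open>i\<close>, \<open>j\<close>, \<open>k\<close>.\<close>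
  define l where "l = (r $ j * p $ k - r $ k * p $ j) *s axis i 1
    + (r $ k * p $ i - r $ i * p $ k) *s axis j 1 + (r $ i * p $ j - r $ j * p $ i) *s axis k 1"
  have l: "lform l x = (r $ j * p $ k - r $ k * p $ j) * x $ i
    + (r $ k * p $ i - r $ i * p $ k) * x $ j + (r $ i * p $ j - r $ j * p $ i) * x $ k" for x
    unfolding lform_commute[of l x] unfolding l_def lform_add lform_scale lform_axis by simp
  show thesis
  proof (rule that)
    have "l $ k \<noteq> 0" using ij k by (simp add: l_def axis_def)
    then show "l \<noteq> 0" by auto
    show "lform l p = 0" by (simp add: l algebra_simps)
    fix x :: "int ^ 'n" assume x: "parallel (ivec x) q"
    obtain b where b: "r $ b \<noteq> 0" using r(1) by (auto simp: vec_eq_iff)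
    obtain c where c: "ivec x = c *s q" using parallel_imp_multiple[OF x q0] .
    obtain d where d: "ivec r = d *s q" using parallel_imp_multiple[OF r(2) q0] .
    have "x $ a * r $ b = x $ b * r $ a" for a
    proof -
      have "(of_int (x $ a) :: 'k) = c * q $ a" "(of_int (x $ b) :: 'k) = c * q $ b"
        "(of_int (r $ a) :: 'k) = d * q $ a" "(of_int (r $ b) :: 'k) = d * q $ b"
        using c d by (auto simp: vec_eq_iff)
      then have "(of_int (x $ a * r $ b) :: 'k) = of_int (x $ b * r $ a)" by simp
      then show ?thesis by (simp only: of_int_eq_iff)
    qed
    then have "lform l x * r $ b = x $ b * lform l r"
      by (simp add: lform_def sum_distrib_left sum_distrib_right mult_ac)
    also have "lform l r = 0" by (simp add: l algebra_simps)
    finally show "lform l x = 0" using b by simp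
  qed
next
  case False
  have "p \<noteq> 0" using pq by (auto simp: qbil_def)
  then obtain i where i: "p $ i \<noteq> 0" by (auto simp: vec_eq_iff)
  have "\<exists>j. j \<noteq> i"
  proof (rule ccontr)
    assume "\<not> (\<exists>j. j \<noteq> i)"
    then have "CARD('n) = card {i}" by (intro arg_cong[where f = card]) blast
    with n show False by simp
  qed
  then obtain j where j: "j \<noteq> i" by auto
  define l where "l = p $ i *s axis j 1 + (- p $ j) *s axis i 1"
  show thesis
  proof (rule that)
    have "l $ j \<noteq> 0" using i j by (simp add: l_def axis_def)
    then show "l \<noteq> 0" by auto
    show "lform l p = 0"
      unfolding lform_commute[of l p] unfolding l_def lform_add lform_scale lform_axis by simp
    fix x :: "int ^ 'n" assume "parallel (ivec x) q"
    then have "x = 0" using False by blast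
    then show "lform l x = 0" by (simp add: lform_def)
  qed
qed

text \<open>Density is applied to the closed set \<open>W\<close> cut out by the single form \<open>H = B(p,x) l(x)\<close>: it does
  not contain the quadric, since \<open>H(\<phi>(t)) = B(p,t)\<^sup>3 l(t)\<close>, so it does not contain \<open>Y\<close> either.
  The form \<open>G\<close> is one of the equations of the complement of \<open>Y\<close> that fails at the
  resulting point.\<close>

lemma dense_open_point:
  fixes F :: "('n::finite, int) mpoly"
  assumes F: "homogeneous 2 F" and Y: "open_dense_in Y (quadric F)"
    and p: "qform F p = 0" and l: "lform l p = 0" and t: "qbil F p t \<noteq> 0" "lform l t \<noteq> 0"
  obtains G d x where "homogeneous d G" "meval of_rat G x \<noteq> 0"
    "qform F (x :: complex ^ 'n) = 0" "qbil F (ivec p) x \<noteq> 0" "lform l x \<noteq> 0"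
    "\<And>y. \<lbrakk>y \<noteq> 0; qform F y = 0; meval of_rat G y \<noteq> 0\<rbrakk> \<Longrightarrow> abs_ppoint y \<in> Y"
proof -
  have on_quadric: "abs_ppoint y \<in> quadric F \<longleftrightarrow> qform F y = 0" if "y \<noteq> 0" for y :: "complex ^ 'n"
    using vanishes_at_abs_ppoint[OF F that] by (simp add: quadric_def meval_quadratic[OF F])
  define H where "H = form_product (gradient F p) l"
  have H: "homogeneous 2 H" unfolding H_def by (rule homogeneous_form_product)
  have mH: "meval of_rat H y = qbil F (ivec p) y * lform l y" for y :: "complex ^ 'n"
    by (simp add: H_def meval_form_product qbil_gradient)
  define W :: "(complex, 'n) ppoint set" where "W = {P. vanishes_at of_rat H P}"
  have W: "zariski_closed W"
    unfolding zariski_closed_def W_def using H by (intro exI[of _ "{H}"]) auto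
  have "\<not> quadric F \<subseteq> W"
  proof
    assume sub: "quadric F \<subseteq> W"
    define z where "z = stereo F p t"
    have "qbil F p z = - (qbil F p t)\<^sup>2" unfolding z_def by (rule qbil_stereo[OF p])
    then have b: "qbil F p z \<noteq> 0" using t by simp
    have c: "lform l z \<noteq> 0" using t by (simp add: z_def lform_stereo l)
    have z0: "(ivec z :: complex ^ 'n) \<noteq> 0" using b by (auto simp: qbil_def)
    have "abs_ppoint (ivec z :: complex ^ 'n) \<in> quadric F"
      using on_quadric[OF z0] qform_stereo[OF p] by (simp add: qform_ivec z_def)
    then have "meval of_rat H (ivec z :: complex ^ 'n) = 0"
      using sub vanishes_at_abs_ppoint[OF H z0, of of_rat] by (auto simp: W_def)
    then show False using b c by (simp add: mH qbil_ivec lform_ivec)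
  qed
  with Y W obtain P where P: "P \<in> Y" "P \<notin> W"
    unfolding open_dense_in_def by blast
  obtain Z where Z: "zariski_closed Z" "Y = quadric F - Z"
    using Y by (auto simp: open_dense_in_def)
  obtain S :: "('n, rat) mpoly set" where S: "\<And>G. G \<in> S \<Longrightarrow> \<exists>d. homogeneous d G"
    "Z = {P. \<forall>G\<in>S. vanishes_at of_rat G P}"
    using Z(1) unfolding zariski_closed_def by auto
  obtain G where G: "G \<in> S" "\<not> vanishes_at of_rat G P"
    using P(1) Z(2) S(2) by auto
  obtain d where d: "homogeneous d G" using S(1) G(1) by blast
  obtain x where x: "x \<noteq> 0" "P = abs_ppoint x" by (rule ppoint_cases)
  show thesis
  proof (rule that[OF d])
    show "meval of_rat G x \<noteq> 0"
      using G(2) x vanishes_at_abs_ppoint[OF d x(1), of of_rat] by simp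
    show "qform F x = 0"
      using P(1) Z(2) x on_quadric by blast
    have "meval of_rat H x \<noteq> 0"
      using P(2) x vanishes_at_abs_ppoint[OF H x(1), of of_rat] by (simp add: W_def)
    then show "qbil F (ivec p) x \<noteq> 0" "lform l x \<noteq> 0" by (auto simp: mH)
    fix y :: "complex ^ 'n"
    assume y: "y \<noteq> 0" "qform F y = 0" "meval of_rat G y \<noteq> 0"
    then have "abs_ppoint y \<notin> Z"
      using G(1) S(2) vanishes_at_abs_ppoint[OF d y(1), of of_rat] by auto
    then show "abs_ppoint y \<in> Y" using y on_quadric Z(2) by blast
  qed
qed

text \<open>The polynomial \<open>G(\<phi>(t)) B(p,t) l(t)\<close> is nonzero at the point of the preceding lemma, because \<open>\<phi>\<close>
  fixes that point projectively.  So it is nonzero somewhere on every sufficiently large grid of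
  integers, although that point is complex and possibly far from the grid.\<close>

lemma grid_avoidance:
  fixes F :: "('n::finite, int) mpoly"
  assumes F: "homogeneous 2 F" and Y: "open_dense_in Y (quadric F)"
    and p: "qform F p = 0" and l: "lform l p = 0" and t: "qbil F p t \<noteq> 0" "lform l t \<noteq> 0"
  obtains D where "\<And>S :: 'n \<Rightarrow> int set. (\<And>i. finite (S i)) \<Longrightarrow> (\<And>i. card (S i) = D + 1) \<Longrightarrow>
    \<exists>T. (\<forall>i. T $ i \<in> S i) \<and> stereo F p T \<noteq> 0 \<and> abs_ppoint (ivec (stereo F p T)) \<in> Y
      \<and> lform l (stereo F p T) \<noteq> 0"
proof -
  obtain G d x where G: "homogeneous d G" "meval of_rat G x \<noteq> 0"
    and x: "qform F (x :: complex ^ 'n) = 0" "qbil F (ivec p) x \<noteq> 0" "lform l x \<noteq> 0"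
    and inY: "\<And>y. \<lbrakk>y \<noteq> 0; qform F y = 0; meval of_rat G y \<noteq> 0\<rbrakk> \<Longrightarrow> abs_ppoint y \<in> Y"
    by (rule dense_open_point[OF assms]) blast
  define f where "f y = meval of_rat G (stereo F (ivec p) y) * (qbil F (ivec p) y * lform l y)"
    for y :: "complex ^ 'n"
  have "polyfun f"
    unfolding f_def
    by (intro polyfun_mult polyfun_meval polyfun_qbil polyfun_lform)
       (unfold stereo_nth, intro polyfun_mult polyfun_diff polyfun_qform polyfun_qbil polyfun_const polyfun_coord)
  then obtain D where D: "coordpoly D f" by (auto simp: polyfun_def)
  have fx: "f x \<noteq> 0"
    unfolding f_def stereo_on_quadric[OF x(1)] meval_scale[OF G(1)] using G x by simp
  show thesis
  proof (rule that[of D])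
    fix S :: "'n \<Rightarrow> int set"
    assume S: "\<And>i. finite (S i)" "\<And>i. card (S i) = D + 1"
    obtain s where s: "\<And>i. s $ i \<in> of_int ` S i" "f s \<noteq> 0"
      by (rule coordpoly_grid[OF D fx, of "\<lambda>i. of_int ` S i"])
         (use S in \<open>auto simp: card_image inj_on_def\<close>)
    have "\<forall>i. \<exists>a. a \<in> S i \<and> s $ i = of_int a" using s(1) by blast
    then obtain a where a: "\<And>i. a i \<in> S i" "\<And>i. s $ i = of_int (a i)" by metis
    define T where "T = (\<chi> i. a i)"
    have sT: "s = ivec T" using a(2) by (simp add: T_def vec_eq_iff)
    have f: "meval of_rat G (ivec (stereo F p T) :: complex ^ 'n) \<noteq> 0" "qbil F p T \<noteq> 0" "lform l T \<noteq> 0"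
      using s(2) by (auto simp: f_def sT stereo_ivec qbil_ivec lform_ivec)
    have lT: "lform l (stereo F p T) \<noteq> 0" using f by (simp add: lform_stereo l)
    then have z: "stereo F p T \<noteq> 0" by (metis lform_0)
    have "abs_ppoint (ivec (stereo F p T)) \<in> Y"
      using z f(1) by (intro inY) (simp_all add: qform_ivec qform_stereo[OF p])
    then show "\<exists>T. (\<forall>i. T $ i \<in> S i) \<and> stereo F p T \<noteq> 0 \<and> abs_ppoint (ivec (stereo F p T)) \<in> Y
      \<and> lform l (stereo F p T) \<noteq> 0"
      using z lT a(1) by (intro exI[of _ T]) (simp add: T_def)
  qed
qed

section \<open>The upper bound\<close>

lemma infinite_if_values_accumulate:
  fixes f :: "'a \<Rightarrow> real"
  assumes "\<And>e. e > 0 \<Longrightarrow> \<exists>a\<in>A. 0 < f a \<and> f a < e"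
  shows "infinite A"
proof
  assume "finite A"
  define V where "V = {v \<in> f ` A. 0 < v}"
  have "finite V" using \<open>finite A\<close> by (simp add: V_def)
  have "V \<noteq> {}" using assms[of 1] by (auto simp: V_def)
  then have "Min V > 0" using Min_in[OF \<open>finite V\<close>] by (auto simp: V_def)
  then obtain a where a: "a \<in> A" "0 < f a" "f a < Min V" using assms by blast
  then have "Min V \<le> f a" using \<open>finite V\<close> by (intro Min_le) (auto simp: V_def)
  with a show False by simp
qed

text \<open>Dividing by a coordinate of largest absolute value puts all coordinates into the unit ball, where
  the integer approximation applies at every place.\<close>

lemma normalised_representative:
  fixes Q :: "('k::field_char_0, 'n::finite) ppoint"
  assumes "abs_value av"
  obtains q j where "q \<noteq> 0" "Q = abs_ppoint q" "q $ j = 1" "\<And>i. av (q $ i) \<le> 1"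
proof -
  interpret abs_value av by (rule assms)
  obtain x where x: "x \<noteq> 0" "Q = abs_ppoint x" by (rule ppoint_cases)
  have "Max (range (\<lambda>i. av (x $ i))) \<in> range (\<lambda>i. av (x $ i))" by (intro Max_in) auto
  then obtain j where j: "Max (range (\<lambda>i. av (x $ i))) = av (x $ j)" by (rule imageE)
  then have xj: "av (x $ j) > 0" using max_coord_pos[OF x(1)] by simp
  then have xj0: "x $ j \<noteq> 0" using xj eq_0_iff[of "x $ j"] by auto
  define q where "q = (1 / x $ j) *s x"
  have qj: "q $ j = 1" using xj0 by (simp add: q_def)
  then have q0: "q \<noteq> 0" by auto
  have "Q = abs_ppoint q" unfolding q_def x(2) using x(1) xj0 by (simp add: abs_ppoint_scale)
  moreover have "av (q $ i) \<le> 1" for i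
  proof -
    have "av (q $ i) * av (x $ j) = av (x $ i)"
      unfolding mult[symmetric] using xj0 by (simp add: q_def)
    also have "\<dots> \<le> av (x $ j)" unfolding j[symmetric] by (intro Max_ge) auto
    finally show ?thesis using xj by simp
  qed
  ultimately show thesis using that q0 qj by blast
qed

text \<open>All constants, including the number \<open>D\<close> of spare choices in each coordinate, depend only on
  \<open>F\<close>, \<open>q\<close>, \<open>Y\<close> and the auxiliary vectors \<open>p\<close> and \<open>l\<close>; the size \<open>N\<close> of the approximation is chosen
  last, and one point at positive distance below each \<open>\<epsilon>\<close> yields infinitely many.\<close>

lemma infinitely_many_approximations:
  fixes F :: "('n::finite, int) mpoly" and av :: "'k::field_char_0 \<Rightarrow> real"
  assumes n: "CARD('n) \<ge> 3" and F: "homogeneous 2 F" "nondegenerate F"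
    and V: "(quadric F :: (rat, 'n) ppoint set) \<noteq> {}"
    and \<nu>: "place \<nu>" and K: "completion_of_rat \<nu> av" and Q: "Q \<in> quadric F"
    and Y: "open_dense_in Y (quadric F)" and \<gamma>: "\<gamma> > 2"
  shows "infinite {P \<in> rational_points Y. pdist av (rat_point P) Q powr \<gamma> * height P < 1}"
proof -
  interpret abs_value av using K by (rule completion_abs_value)
  obtain q j where q: "q \<noteq> 0" "Q = abs_ppoint q" "q $ j = 1" "\<And>i. av (q $ i) \<le> 1"
    by (rule normalised_representative[OF abs_value_axioms]) blast
  have Fq: "qform F q = 0"
    using Q vanishes_at_abs_ppoint[OF F(1) q(1), of of_int]
    by (simp add: quadric_def q(2) meval_quadratic[OF F(1)])
  obtain p0 :: "int ^ 'n" where p0: "p0 \<noteq> 0" "qform F p0 = 0"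
  proof -
    obtain P :: "(rat, 'n) ppoint" where "P \<in> quadric F" using V by blast
    moreover obtain x where x: "x \<noteq> 0" "P = abs_ppoint x" by (rule ppoint_cases)
    ultimately have Fx: "qform F x = 0"
      using vanishes_at_abs_ppoint[OF F(1) x(1), of of_int]
      by (simp add: quadric_def meval_quadratic[OF F(1)])
    obtain c z where z: "c \<noteq> 0" "ivec z = of_int c *s x" by (rule clear_denominators)
    have "of_int (qform F z) = (0 :: rat)"
      unfolding qform_ivec[symmetric] z(2) qform_scale Fx by simp
    moreover have "(ivec z :: rat ^ 'n) \<noteq> 0" unfolding z(2) using z(1) x(1) by (auto simp: vec_eq_iff)
    ultimately show thesis using that[of z] by simp
  qed
  obtain p :: "int ^ 'n" where p: "qform F p = 0" "qbil F (ivec p) q \<noteq> 0"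
    using isotropic_transversal[OF F q(1) p0] .
  obtain l where l: "l \<noteq> 0" "lform l p = 0" "\<And>x :: int ^ 'n. parallel (ivec x) q \<Longrightarrow> lform l x = 0"
    by (rule annihilating_form[OF n p]) blast
  obtain t where t: "qbil F p t \<noteq> 0" "lform l t \<noteq> 0"
  proof -
    have "p \<noteq> 0" using p(2) by (auto simp: qbil_def)
    then obtain t where "qbil F (ivec t) (ivec p :: rat ^ 'n) \<noteq> 0"
      using nondegenerate_extension[OF F, of "ivec p :: rat ^ 'n"] by auto
    then have "qbil F p t \<noteq> 0" by (simp add: qbil_ivec qbil_commute)
    moreover obtain i where "l $ i \<noteq> 0" using l(1) by (auto simp: vec_eq_iff)
    then have "lform l (axis i 1) \<noteq> (0 :: int)" by simp
    ultimately show thesis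
      using common_nonzero[of "qbil F p" "lform l :: int ^ 'n \<Rightarrow> int"] qbil_add_right lform_add that
      by metis
  qed
  obtain D where D: "\<And>S :: 'n \<Rightarrow> int set. (\<And>i. finite (S i)) \<Longrightarrow> (\<And>i. card (S i) = D + 1) \<Longrightarrow>
    \<exists>T. (\<forall>i. T $ i \<in> S i) \<and> stereo F p T \<noteq> 0 \<and> abs_ppoint (ivec (stereo F p T)) \<in> Y
      \<and> lform l (stereo F p T) \<noteq> 0"
    by (rule grid_avoidance[OF F(1) Y p(1) l(2) t]) blast
  obtain C e0 where C: "0 \<le> C" "0 < e0" and dist: "\<And>e t. \<lbrakk>0 \<le> e; e \<le> e0; \<And>i. av (t $ i - q $ i) \<le> e\<rbrakk>
     \<Longrightarrow> pdist av (abs_ppoint (stereo F (ivec p) t)) (abs_ppoint q) \<le> C * e"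
    by (rule stereo_estimate[OF K Fq q(3,4) p(2)]) blast
  obtain H where H: "0 \<le> H" and height: "\<And>T X. \<lbrakk>stereo F p T \<noteq> 0; \<And>i. \<bar>real_of_int (T $ i)\<bar> \<le> X\<rbrakk>
    \<Longrightarrow> height (abs_ppoint (ivec (stereo F p T))) \<le> H * X\<^sup>2"
    by (rule stereo_height[of F p]) blast
  define A where "A = real (D + 3)"
  have A: "A > 0" by (simp add: A_def)
  show ?thesis
  proof (rule infinite_if_values_accumulate[where f = "\<lambda>P. pdist av (rat_point P) Q"])
    fix \<epsilon> :: real assume \<epsilon>: "\<epsilon> > 0"
    have "((\<lambda>N. A * N powr (- 1)) \<longlongrightarrow> A * 0) at_top"
      by (intro tendsto_intros tendsto_neg_powr filterlim_ident) auto
    then have "\<forall>\<^sub>F N in at_top. A * N powr (- 1) < e0"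
      using C(2) by (intro order_tendstoD(2)) auto
    moreover have "((\<lambda>N. C * A * N powr (- 1)) \<longlongrightarrow> C * A * 0) at_top"
      by (intro tendsto_intros tendsto_neg_powr filterlim_ident) auto
    then have "\<forall>\<^sub>F N in at_top. C * A * N powr (- 1) < \<epsilon>"
      using \<epsilon> by (intro order_tendstoD(2)) auto
    moreover have "((\<lambda>N. (C * A) powr \<gamma> * (H * A\<^sup>2) * N powr (2 - \<gamma>)) \<longlongrightarrow> (C * A) powr \<gamma> * (H * A\<^sup>2) * 0) at_top"
      using \<gamma> by (intro tendsto_intros tendsto_neg_powr filterlim_ident) auto
    then have "\<forall>\<^sub>F N in at_top. (C * A) powr \<gamma> * (H * A\<^sup>2) * N powr (2 - \<gamma>) < 1"
      by (intro order_tendstoD(2)) auto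
    ultimately have "\<forall>\<^sub>F N in at_top. A * N powr (- 1) < e0 \<and> C * A * N powr (- 1) < \<epsilon>
        \<and> (C * A) powr \<gamma> * (H * A\<^sup>2) * N powr (2 - \<gamma>) < 1"
      by eventually_elim blast
    then obtain M where M: "\<And>N. N \<ge> M \<Longrightarrow> A * N powr (- 1) < e0 \<and> C * A * N powr (- 1) < \<epsilon>
        \<and> (C * A) powr \<gamma> * (H * A\<^sup>2) * N powr (2 - \<gamma>) < 1"
      unfolding eventually_at_top_linorder by blast
    obtain N c where N: "N \<ge> M" "N \<ge> 1" and c: "c \<noteq> 0"
      and S: "\<And>x. av x \<le> 1 \<Longrightarrow> \<exists>S :: int set. finite S \<and> card S = D + 1 \<and>
       (\<forall>s\<in>S. \<bar>of_int s\<bar> \<le> A * N \<and> av (of_rat c * of_int s - x) \<le> A / N)"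
      unfolding A_def by (rule integer_approximation[OF \<nu> K, of M D]) blast
    have small: "A / N \<le> e0" "C * (A / N) < \<epsilon>"
        "(C * A) powr \<gamma> * (H * A\<^sup>2) * N powr (2 - \<gamma>) < 1"
      using M[OF N(1)] N(2) by (simp_all add: powr_minus divide_inverse less_imp_le mult.assoc)
    obtain S where S: "\<And>i. finite (S i)" "\<And>i. card (S i) = D + 1"
      "\<And>i s. s \<in> S i \<Longrightarrow> \<bar>of_int s\<bar> \<le> A * N \<and> av (of_rat c * of_int s - q $ i) \<le> A / N"
      using S[OF q(4)] by metis
    obtain T where T: "\<And>i. T $ i \<in> S i" "stereo F p T \<noteq> 0" "abs_ppoint (ivec (stereo F p T)) \<in> Y"
      "lform l (stereo F p T) \<noteq> 0"
      using D[of S, OF S(1,2)] by blast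
    define z where "z = stereo F p T"
    define P where "P = (abs_ppoint (ivec z) :: (rat, 'n) ppoint)"
    have z0: "z \<noteq> 0" using T(2) by (simp add: z_def)
    have ratP: "rat_point P = (abs_ppoint (ivec z) :: ('a::field_char_0, 'n) ppoint)"
    proof -
      have "(\<chi> i. of_rat (ivec z $ i)) = (ivec z :: 'a ^ 'n)" by (simp add: vec_eq_iff)
      then show ?thesis using z0 by (simp add: P_def rat_point_abs_ppoint)
    qed
    have PY: "P \<in> rational_points Y"
      using T(3) by (simp add: rational_points_def ratP z_def)
    have scaled: "stereo F (ivec p) (of_rat c *s ivec T) = (of_rat c)\<^sup>2 *s (ivec z :: 'k ^ 'n)"
      by (simp add: stereo_scale stereo_ivec z_def)
    have "pdist av (abs_ppoint (stereo F (ivec p) (of_rat c *s ivec T))) (abs_ppoint q) \<le> C * (A / N)"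
    proof (rule dist)
      fix i
      show "av ((of_rat c *s ivec T) $ i - q $ i) \<le> A / N"
        using S(3)[OF T(1)] by simp
    qed (use small(1) A N(2) in auto)
    moreover have "abs_ppoint (stereo F (ivec p) (of_rat c *s ivec T)) = (abs_ppoint (ivec z) :: ('k, 'n) ppoint)"
      unfolding scaled using z0 c by (intro abs_ppoint_scale) auto
    ultimately have dP: "pdist av (rat_point P) Q \<le> C * (A / N)"
      by (simp add: ratP q(2))
    have "\<not> parallel (ivec z) q" using l(3) T(4) by (auto simp: z_def)
    then have dpos: "0 < pdist av (rat_point P) Q"
      unfolding ratP q(2) using z0 q(1) by (intro pdist_pos[OF K]) auto
    have hP: "height P \<le> H * (A * N)\<^sup>2"
      unfolding P_def z_def using S(3)[OF T(1)] by (intro height T(2)) auto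
    have "pdist av (rat_point P) Q powr \<gamma> * height P \<le> pdist av (rat_point P) Q powr \<gamma> * (H * (A * N)\<^sup>2)"
      by (intro mult_left_mono hP) auto
    also have "\<dots> \<le> (C * (A / N)) powr \<gamma> * (H * (A * N)\<^sup>2)"
      using dP dpos \<gamma> H by (intro mult_right_mono powr_mono2) auto
    also have "\<dots> = (C * A) powr \<gamma> * (H * A\<^sup>2) * N powr (2 - \<gamma>)"
    proof -
      have "(C * (A / N)) powr \<gamma> = (C * A) powr \<gamma> / N powr \<gamma>"
        using C A N powr_divide[of "C * A" N \<gamma>] by simp
      moreover have "N powr (2 - \<gamma>) = N\<^sup>2 / N powr \<gamma>"
        using N by (simp add: powr_diff powr_numeral)
      ultimately show ?thesis by (simp add: power_mult_distrib)
    qed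
    also have "\<dots> < 1" by (rule small)
    finally have "P \<in> {P \<in> rational_points Y. pdist av (rat_point P) Q powr \<gamma> * height P < 1}"
      using PY by simp
    moreover have "pdist av (rat_point P) Q < \<epsilon>" using dP small(2) by simp
    ultimately show "\<exists>P\<in>{P \<in> rational_points Y. pdist av (rat_point P) Q powr \<gamma> * height P < 1}.
        0 < pdist av (rat_point P) Q \<and> pdist av (rat_point P) Q < \<epsilon>"
      using dpos by blast
  qed
qed

theorem theoremA3:
  fixes F :: "('n::finite, int) mpoly"
    and \<nu> :: "rat \<Rightarrow> real"
    and av :: "'k::field_char_0 \<Rightarrow> real"
    and Q\<^sub>0 :: "('k, 'n) ppoint"
  assumes "CARD('n) = n + 1" and "n \<ge> 4"
    and "homogeneous 2 F" and "nondegenerate F"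
    and "(quadric F :: (rat, 'n) ppoint set) \<noteq> {}"
    and "place \<nu>" and "completion_of_rat \<nu> av"
    and "Q\<^sub>0 \<in> quadric F"
  shows "ess_const av (quadric F) Q\<^sub>0 \<le> 2"
proof -
  have "approx_const av Q\<^sub>0 Y \<le> 2" if Y: "open_dense_in Y (quadric F)" for Y
  proof (rule ereal_le_epsilon)
    fix e :: ereal assume e: "0 < e"
    show "approx_const av Q\<^sub>0 Y \<le> 2 + e"
    proof (cases e)
      case (real r)
      then have "infinite {P \<in> rational_points Y. pdist av (rat_point P) Q\<^sub>0 powr (2 + r) * height P < 1}"
        using assms e by (intro infinitely_many_approximations[OF _ assms(3-8) Y]) auto
      then have "approx_const av Q\<^sub>0 Y \<le> ereal (2 + r)"
        unfolding approx_const_def using real e by (intro Inf_lower) auto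
      then show ?thesis using real by simp
    qed (use e in auto)
  qed
  then show ?thesis
    unfolding ess_const_def by (auto intro: Sup_least)
qed

end
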